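(* Let $\Gamma$ be a subgroup of $\mathrm{Diff}^{\omega}_+(S^1)$ which is nondiscrete with respect to the $C^1$-topology. Then $\rho(\Gamma)\subset \mathbb{R}/\mathbb{Z}$ is a finite set if and only if $\Gamma$ has a finite orbit in $S^1$.
   Context: $\mathrm{Diff}^{\omega}_+(S^1)$ is the group of orientation-preserving real analytic diffeomorphisms of the circle $S^1=\mathbb{R}/\mathbb{Z}$. Rotation number: for $f\in\mathrm{Homeo}_+(S^1)$ choose a lift $\tilde f:\mathbb{R}\to\mathbb{R}$ (a homeomorphism commuting with integer translations); the translation number $\tau(\tilde f)=\lim_{n\to\infty}(\tilde f^n(x)-x)/n$ exists and is independent of $x$, and $\rho(f)=\tau(\tilde f) \bmod \mathbb{Z}\in\mathbb{R}/\mathbb{Z}$. "$\Gamma$ has a finite image under the rotation number function" means $\rho(\Gamma)$ is finite. $\Gamma$ is nondiscrete with respect to the $C^1$-topology if there is a sequence of elements of $\Gamma\setminus\{\mathrm{id}\}$ converging to the identity in the $C^1$-topology on $S^1$. A finite orbit is a point $x$ with $\Gamma x$ finite. *)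

theory Defs
  imports "HOL-Analysis.Analysis"
begin

text \<open>Circle S^1 = R/Z. A circle map is represented by its lifts R -> R.
  A subgroup Gamma of Diff^omega_+(S^1) is represented by the set of ALL lifts of
  its elements, which is a group under composition containing the unit translation.\<close>

definition real_analytic :: "(real \<Rightarrow> real) \<Rightarrow> bool" where
  "real_analytic f \<longleftrightarrow>
     (\<forall>x0. \<exists>r>0. \<exists>a::nat \<Rightarrow> real. \<forall>x. \<bar>x - x0\<bar> < r \<longrightarrow> (\<lambda>n. a n * (x - x0) ^ n) sums f x)"

definition analytic_circle_lift :: "(real \<Rightarrow> real) \<Rightarrow> bool" where
  "analytic_circle_lift F \<longleftrightarrow>
     bij F \<and> strict_mono F \<and> real_analytic F \<and> real_analytic (inv F) \<and>
     (\<forall>x. F (x + 1) = F x + 1)"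

definition lifted_subgroup :: "(real \<Rightarrow> real) set \<Rightarrow> bool" where
  "lifted_subgroup G \<longleftrightarrow>
     (\<forall>F\<in>G. analytic_circle_lift F) \<and> id \<in> G \<and> (\<lambda>x. x + 1) \<in> G \<and>
     (\<forall>F\<in>G. \<forall>H\<in>G. F \<circ> H \<in> G) \<and> (\<forall>F\<in>G. inv F \<in> G)"

definition transl_num :: "(real \<Rightarrow> real) \<Rightarrow> real" where
  "transl_num F = lim (\<lambda>n. ((F ^^ n) 0 - 0) / real n)"

definition rot_image :: "(real \<Rightarrow> real) set \<Rightarrow> real set" where
  "rot_image G = {frac (transl_num F) | F. F \<in> G}"

definition lifts_identity :: "(real \<Rightarrow> real) \<Rightarrow> bool" where
  "lifts_identity F \<longleftrightarrow> (\<exists>k::int. \<forall>x. F x = x + of_int k)"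

definition C1_nondiscrete :: "(real \<Rightarrow> real) set \<Rightarrow> bool" where
  "C1_nondiscrete G \<longleftrightarrow>
     (\<exists>g::nat \<Rightarrow> real \<Rightarrow> real. (\<forall>n. g n \<in> G \<and> \<not> lifts_identity (g n)) \<and>
        (\<forall>\<epsilon>>0. \<forall>\<^sub>F n in sequentially. \<forall>x. \<bar>g n x - x\<bar> < \<epsilon> \<and> \<bar>deriv (g n) x - 1\<bar> < \<epsilon>))"

definition has_finite_orbit :: "(real \<Rightarrow> real) set \<Rightarrow> bool" where
  "has_finite_orbit G \<longleftrightarrow> (\<exists>x. finite {frac (F x) | F. F \<in> G})"

end

theory Submission
  imports Defs "HOL-Complex_Analysis.Cauchy_Integral_Formula"
begin

text \<open>
  A finite orbit of size at most n forces every translation number to have a denominator at most n.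

  Conversely, suppose that the rotation numbers are finite in number, so that no element has a
  small nonzero translation number, and that there is no finite orbit. A nontrivial element close
  to the identity then has a fixed point, and some f in the group contracts one side of a fixed
  point c lying in a minimal set. Conjugating C1-small elements by powers of f magnifies them: by
  bounded distortion, as soon as a displacement is comparable with the length of a fundamental
  domain of f, its conjugate is a small displacement without zeros on one fixed interval. Hence
  the minimal set has interior and the action is minimal.

  Let \<Theta> x be the supremum of the points y such that the interval from x to y can be shrunk to
  arbitrarily small length. Minimality makes \<Theta> a homeomorphism commuting with the group, and the
  complement of an interval modulo \<Theta> can be shrunk into any given place. Conjugating the small
  displacements accordingly gives elements that move every point slowly to the right, except on a
  tiny arc modulo \<Theta> whose position can be prescribed. Two such elements a and b with disjoint
  exceptional arcs combine to w = b o a^i without fixed points; choosing b among many candidates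
  as the one whose exceptional arc is crossed first by the iterates of a keeps w slow, so the
  translation number of w is positive and as small as desired, a contradiction.
\<close>

section \<open>Real analytic functions\<close>

text \<open>A power series can be differentiated term by term inside its interval of convergence, so
  a local expansion of \<open>f\<close> yields one of \<open>deriv f\<close> with the same
  radius.\<close>

lemma real_analytic_has_deriv:
  assumes "real_analytic f"
  shows "(f has_real_derivative deriv f x) (at x)"
    and "real_analytic (deriv f)"
proof -
  have loc: "\<exists>r>0. \<exists>a::nat \<Rightarrow> real. \<forall>x. \<bar>x - x0\<bar> < r \<longrightarrow>
      (f has_real_derivative deriv f x) (at x) \<and> (\<lambda>n. a n * (x - x0) ^ n) sums deriv f x" for x0
  proof -
    obtain r a where r: "r > 0" and a: "\<And>x. \<bar>x - x0\<bar> < r \<Longrightarrow> (\<lambda>n. a n * (x - x0) ^ n) sums f x"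
      using assms unfolding real_analytic_def by metis
    have sm: "summable (\<lambda>n. a n * z ^ n)" if "norm z < r" for z
      using a[of "x0 + z"] that by (auto simp: sums_iff)
    have D: "(f has_real_derivative (\<Sum>n. diffs a n * (x - x0) ^ n)) (at x)"
      if x: "\<bar>x - x0\<bar> < r" for x
    proof -
      have "((\<lambda>z. \<Sum>n. a n * z ^ n) has_real_derivative (\<Sum>n. diffs a n * (x - x0) ^ n)) (at (x - x0))"
        using termdiffs_strong'[of r a "x - x0"] sm x by auto
      then have "((\<lambda>x. \<Sum>n. a n * (x - x0) ^ n) has_real_derivative (\<Sum>n. diffs a n * (x - x0) ^ n)) (at x)"
        using DERIV_chain2[where g = "\<lambda>x. x - x0" and f = "\<lambda>z. \<Sum>n. a n * z ^ n" and x = x and Db = 1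
            and Da = "\<Sum>n. diffs a n * (x - x0) ^ n" and s = UNIV]
          DERIV_diff[OF DERIV_ident DERIV_const, of x0 x UNIV] by simp
      moreover have "eventually (\<lambda>y. y \<in> ball x0 r) (nhds x)"
        using x by (intro eventually_nhds_in_open) (auto simp: dist_real_def abs_minus_commute)
      then have "eventually (\<lambda>y. (\<Sum>n. a n * (y - x0) ^ n) = f y) (nhds x)"
        by eventually_elim (use a in \<open>force simp: sums_iff dist_real_def abs_minus_commute\<close>)
      ultimately show ?thesis
        by (subst (asm) DERIV_cong_ev) auto
    qed
    have "(f has_real_derivative deriv f x) (at x) \<and> (\<lambda>n. diffs a n * (x - x0) ^ n) sums deriv f x"
      if x: "\<bar>x - x0\<bar> < r" for x
    proof -
      have "deriv f x = (\<Sum>n. diffs a n * (x - x0) ^ n)"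
        using D[OF x] by (rule DERIV_imp_deriv)
      moreover have "summable (\<lambda>n. diffs a n * (x - x0) ^ n)"
        using termdiff_converges[of "x - x0" r a] sm x by auto
      ultimately show ?thesis
        using D[OF x] by (auto simp: sums_iff)
    qed
    with r show ?thesis by blast
  qed
  show "(f has_real_derivative deriv f x) (at x)"
    using loc[of x] by force
  show "real_analytic (deriv f)"
    unfolding real_analytic_def using loc by meson
qed

text \<open>Turns fixed points of \<open>f\<close> into zeros of an analytic function, to which the
  identity theorem below applies.\<close>

lemma real_analytic_diff_id:
  assumes "real_analytic f"
  shows "real_analytic (\<lambda>x. f x - x)"
  unfolding real_analytic_def
proof
  fix x0
  obtain r a where r: "r > 0" and a: "\<And>x. \<bar>x - x0\<bar> < r \<Longrightarrow> (\<lambda>n. a n * (x - x0) ^ n) sums f x"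
    using assms unfolding real_analytic_def by metis
  define b :: "nat \<Rightarrow> real" where "b n = (if n = 0 then x0 else if n = 1 then 1 else 0)" for n
  have b: "(\<lambda>n. b n * (x - x0) ^ n) sums x" for x
    using sums_finite[of "{0, 1}" "\<lambda>n. b n * (x - x0) ^ n"] by (auto simp: b_def)
  have "(\<lambda>n. (a n - b n) * (x - x0) ^ n) sums (f x - x)" if "\<bar>x - x0\<bar> < r" for x
    using sums_diff[OF a[OF that] b[of x]] by (simp add: algebra_simps)
  with r show "\<exists>r>0. \<exists>a. \<forall>x. \<bar>x - x0\<bar> < r \<longrightarrow> (\<lambda>n. a n * (x - x0) ^ n) sums (f x - x)"
    by (intro exI[of _ r] conjI exI[of _ "\<lambda>n. a n - b n"]) auto
qed

text \<open>Identity theorem: the set \<open>A\<close> of accumulation points of zeros is closed,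
  and it is open because a power series that is not constant cannot have zeros accumulating at its
  centre. Connectedness of the line does the rest.\<close>

lemma real_analytic_limpt_zeros:
  fixes f :: "real \<Rightarrow> real"
  assumes f: "real_analytic f" and z: "z islimpt {x. f x = 0}"
  shows "f y = 0"
proof -
  define A where "A = {x. x islimpt {x. f x = 0}}"
  have loc: "\<exists>r>0. \<forall>y. \<bar>y - x\<bar> < r \<longrightarrow> f y = 0" if "x \<in> A" for x
  proof -
    have lim: "x islimpt {x. f x = 0}" using that by (simp add: A_def)
    obtain r a where r: "r > 0" and a: "\<And>y. \<bar>y - x\<bar> < r \<Longrightarrow> (\<lambda>n. a n * (y - x) ^ n) sums f y"
      using f unfolding real_analytic_def by metis
    have cont: "continuous_on UNIV f"
      using real_analytic_has_deriv(1)[OF f]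
      by (auto intro!: continuous_at_imp_continuous_on DERIV_isCont)
    have "closed {x. f x = 0}"
      using continuous_closed_vimage[of "{0}" f] cont
      by (simp add: vimage_def continuous_on_eq_continuous_at)
    with lim have fx: "f x = 0"
      by (auto simp: closed_limpt)
    have "a m = 0" if "m > 0" for m
    proof (rule ccontr)
      assume "a m \<noteq> 0"
      have "\<And>y. norm (y - x) < r \<Longrightarrow> (\<lambda>n. a n * (y - x) ^ n) sums f y"
        using a by simp
      from powser_0_nonzero[OF r this fx \<open>a m \<noteq> 0\<close> that]
      obtain s where s: "s > 0" "\<And>z. z \<in> cball x s - {x} \<Longrightarrow> f z \<noteq> 0"
        by blast
      obtain w where "f w = 0" "w \<noteq> x" "dist w x < s"
        using lim s(1) by (auto simp: islimpt_approachable)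
      with s(2)[of w] show False by (auto simp: dist_commute)
    qed
    moreover have "a 0 = 0"
      using a[of x] r fx sums_unique2[OF powser_sums_zero[of a]] by (simp add: power_0_left)
    ultimately have "a m = 0" for m by (cases m) auto
    then have "f y = 0" if "\<bar>y - x\<bar> < r" for y
      using a[OF that] sums_unique2[OF sums_zero] by auto
    with r show ?thesis by blast
  qed
  have "open A"
    unfolding open_dist
  proof
    fix x assume "x \<in> A"
    then obtain r where r: "r > 0" "\<And>y. \<bar>y - x\<bar> < r \<Longrightarrow> f y = 0" using loc by meson
    have "y \<in> A" if "dist y x < r" for y
    proof -
      have "y islimpt ball x r"
        using that r(1) by (simp add: dist_commute islimpt_ball)
      then show ?thesis
        unfolding A_def mem_Collect_eq
        by (rule islimpt_subset) (use r(2) in \<open>auto simp: dist_real_def abs_minus_commute\<close>)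
    qed
    with r(1) show "\<exists>e>0. \<forall>y. dist y x < e \<longrightarrow> y \<in> A" by blast
  qed
  moreover have "closed A" unfolding A_def by (rule closed_limpts)
  moreover have "A \<noteq> {}" using z by (auto simp: A_def)
  ultimately have "A = UNIV" by (metis clopen)
  then show ?thesis using loc[of y] by force
qed

section \<open>Translation numbers\<close>

locale circle_group =
  fixes G :: "(real \<Rightarrow> real) set"
  assumes grp: "lifted_subgroup G"
begin

lemma G_lift: "F \<in> G \<Longrightarrow> analytic_circle_lift F"
  and G_id: "id \<in> G" and G_shift: "(\<lambda>x. x + 1) \<in> G"
  and G_comp: "F \<in> G \<Longrightarrow> H \<in> G \<Longrightarrow> F \<circ> H \<in> G"
  and G_inv: "F \<in> G \<Longrightarrow> inv F \<in> G"
  using grp by (auto simp: lifted_subgroup_def)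

lemma G_bij: "F \<in> G \<Longrightarrow> bij F"
  and G_strict_mono: "F \<in> G \<Longrightarrow> strict_mono F"
  and G_analytic: "F \<in> G \<Longrightarrow> real_analytic F"
  and G_plus1: "F \<in> G \<Longrightarrow> F (x + 1) = F x + 1"
  using G_lift[of F] by (auto simp: analytic_circle_lift_def)

lemma G_less: "F \<in> G \<Longrightarrow> F x < F y \<longleftrightarrow> x < y"
  and G_le: "F \<in> G \<Longrightarrow> F x \<le> F y \<longleftrightarrow> x \<le> y"
  and G_eq: "F \<in> G \<Longrightarrow> F x = F y \<longleftrightarrow> x = y"
  using G_strict_mono[of F] by (auto simp: strict_mono_less strict_mono_less_eq strict_mono_eq)

lemma G_inv_left: "F \<in> G \<Longrightarrow> inv F (F x) = x"
  and G_inv_right: "F \<in> G \<Longrightarrow> F (inv F x) = x"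
  using G_bij[of F] by (auto simp: bij_is_inj bij_is_surj surj_f_inv_f)

lemma G_deriv: "F \<in> G \<Longrightarrow> (F has_real_derivative deriv F x) (at x)"
  using G_analytic real_analytic_has_deriv(1) by blast

lemma G_isCont: "F \<in> G \<Longrightarrow> isCont F x"
  using G_deriv DERIV_isCont by blast

lemma G_continuous_on: "F \<in> G \<Longrightarrow> continuous_on S F"
  using G_isCont continuous_at_imp_continuous_on by blast

lemma G_deriv_continuous_on: "F \<in> G \<Longrightarrow> continuous_on S (deriv F)"
  by (meson DERIV_isCont G_analytic continuous_at_imp_continuous_on real_analytic_has_deriv)

text \<open>Differentiating \<open>inv F (F x) = x\<close> shows that the derivative does not
  vanish, and monotonicity excludes negative values.\<close>

lemma G_deriv_pos:
  assumes F: "F \<in> G" shows "deriv F x > 0"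
proof -
  have "((\<lambda>x. inv F (F x)) has_real_derivative deriv (inv F) (F x) * deriv F x) (at x)"
    by (rule DERIV_chain2[OF G_deriv[OF G_inv[OF F]] G_deriv[OF F]])
  then have "((\<lambda>x. x) has_real_derivative deriv (inv F) (F x) * deriv F x) (at x)"
    by (simp add: G_inv_left[OF F])
  then have "deriv (inv F) (F x) * deriv F x = 1"
    using DERIV_ident DERIV_unique by blast
  moreover have "deriv F x \<ge> 0"
  proof (rule ccontr)
    assume "\<not> deriv F x \<ge> 0"
    then obtain d where "d > 0" "\<And>h. h > 0 \<Longrightarrow> h < d \<Longrightarrow> F (x + h) < F x"
      using has_real_derivative_neg_dec_right[OF G_deriv[OF F], of x] by auto
    from this(2)[of "d/2"] this(1) show False
      using G_less[OF F, of "x + d/2" x] by auto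
  qed
  ultimately show ?thesis
    by (metis less_eq_real_def mult_zero_right zero_neq_one)
qed


lemma G_funpow: "F \<in> G \<Longrightarrow> F ^^ n \<in> G"
  by (induction n) (auto simp: G_id G_comp)

lemma G_plus_int:
  assumes F: "F \<in> G" shows "F (x + of_int k) = F x + of_int k"
proof -
  have nat: "F (x + of_nat n) = F x + of_nat n" for n x
  proof (induction n)
    case (Suc n)
    then show ?case using G_plus1[OF F, of "x + of_nat n"] by (simp add: add_ac)
  qed simp
  show ?thesis
  proof (cases "k \<ge> 0")
    case True
    then show ?thesis using nat[of x "nat k"] by simp
  next
    case False
    then show ?thesis using nat[of "x + of_int k" "nat (- k)"] by simp
  qed
qed

lemma G_translation: "(\<lambda>x. x + of_int k) \<in> G"
proof -
  have *: "(\<lambda>x::real. x + of_nat n) \<in> G" for n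
  proof (induction n)
    case 0 then show ?case using G_id by (simp add: id_def)
  next
    case (Suc n) then show ?case
      using G_comp[OF Suc G_shift] by (simp add: o_def add_ac)
  qed
  have "inv (\<lambda>x::real. x + of_nat n) = (\<lambda>x. x - of_nat n)" for n
    by (rule inv_equality) auto
  then have "(\<lambda>x::real. x - of_nat n) \<in> G" for n
    using G_inv[OF *[of n]] by simp
  with * show ?thesis
    by (cases k rule: int_cases2) auto
qed

section \<open>Estimates for translation numbers\<close>

lemma G_displacement:
  assumes F: "F \<in> G"
  shows "\<bar>(F x - x) - (F y - y)\<bar> < 1"
proof -
  \<comment> \<open>The integer translate \<open>y + k\<close> lies at most 1 below
    \<open>x\<close>, and its displacement is that of \<open>y\<close>.\<close>
  define k where "k = \<lfloor>x - y\<rfloor>"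
  have 1: "y + of_int k \<le> x" "x < y + of_int k + 1"
    unfolding k_def by linarith+
  then have "F (y + of_int k) \<le> F x" "F x < F (y + of_int k + 1)"
    using F by (simp_all add: G_le G_less)
  then have "F y + of_int k \<le> F x" "F x < F y + of_int k + 1"
    using F by (simp_all add: G_plus_int G_plus1)
  with 1 show ?thesis by linarith
qed

text \<open>Displacements of \<open>F ^^ n\<close> at two points differ by less than 1, which makes
  \<open>a n / n\<close> a Cauchy sequence with an explicit rate. One unit of the bound comes from
  the limit, the other from replacing the base point 0 by \<open>x\<close>.\<close>

lemma transl_num_bound:
  assumes F: "F \<in> G"
  shows "\<bar>(F ^^ n) x - x - of_nat n * transl_num F\<bar> \<le> 2"
proof -
  define a where "a n = (F ^^ n) 0" for n
  \<comment> \<open>Each of the \<open>m\<close> applications of \<open>F ^^ n\<close> contributes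
    an error of at most 1.\<close>
  have sub: "\<bar>(F ^^ (n * m)) 0 - of_nat m * a n\<bar> \<le> of_nat m" for n m
  proof (induction m)
    case (Suc m)
    have "(F ^^ (n * Suc m)) 0 = (F ^^ n) ((F ^^ (n * m)) 0)"
      by (simp add: funpow_add)
    moreover have "\<bar>(F ^^ n) ((F ^^ (n * m)) 0) - (F ^^ (n * m)) 0 - (a n - 0)\<bar> \<le> 1"
      using G_displacement[OF G_funpow[OF F], of n "(F ^^ (n * m)) 0" 0] by (simp add: a_def)
    ultimately show ?case using Suc by (simp add: algebra_simps)
  qed simp
  have close: "\<bar>a n / of_nat n - a m / of_nat m\<bar> \<le> 1 / of_nat n + 1 / of_nat m"
    if "n > 0" "m > 0" for n m
  proof -
    have "\<bar>a (n * m) / (of_nat n * of_nat m) - a n / of_nat n\<bar> \<le> 1 / of_nat n" if "n > 0" "m > 0" for n m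
    proof -
      have "\<bar>a (n * m) / (of_nat n * of_nat m) - a n / of_nat n\<bar>
          = \<bar>a (n * m) - of_nat m * a n\<bar> / (of_nat n * of_nat m)"
        using that by (simp add: field_simps abs_divide flip: abs_mult)
      also have "\<dots> \<le> of_nat m / (of_nat n * of_nat m)"
        using sub[of n m] by (intro divide_right_mono) (auto simp: a_def)
      finally show ?thesis using that by simp
    qed
    from this[OF that] this[OF that(2,1)] show ?thesis
      by (simp add: mult.commute)
  qed
  have "Cauchy (\<lambda>n. a n / of_nat n)"
  proof (rule metric_CauchyI)
    fix e :: real assume e: "e > 0"
    obtain N :: nat where N: "2 / e < of_nat N" using reals_Archimedean2 by blast
    have "N > 0" using N e by (cases N) (auto simp: divide_less_0_iff not_less)
    have "dist (a m / of_nat m) (a n / of_nat n) < e" if "m \<ge> N" "n \<ge> N" for m n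
    proof -
      have "1 / of_nat k < e / 2" if "k \<ge> N" for k :: nat
      proof -
        have "2 / e < of_nat k" using N that by (meson less_le_trans of_nat_le_iff)
        then show ?thesis using e \<open>N > 0\<close> that by (auto simp: field_simps)
      qed
      from this[OF that(1)] this[OF that(2)] close[of m n] that \<open>N > 0\<close>
      show ?thesis by (auto simp: dist_real_def)
    qed
    then show "\<exists>M. \<forall>m\<ge>M. \<forall>n\<ge>M. dist (a m / of_nat m) (a n / of_nat n) < e" by blast
  qed
  then have lim: "(\<lambda>n. a n / of_nat n) \<longlonglongrightarrow> transl_num F"
    unfolding transl_num_def a_def by (simp add: Cauchy_convergent_iff convergent_LIMSEQ_iff)
  have "\<bar>a n / of_nat n - transl_num F\<bar> \<le> 1 / of_nat n" if n: "n > 0"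
  proof (rule LIMSEQ_le)
    show "(\<lambda>m. \<bar>a n / of_nat n - a m / of_nat m\<bar>) \<longlonglongrightarrow> \<bar>a n / of_nat n - transl_num F\<bar>"
      by (intro tendsto_intros lim)
    show "(\<lambda>m. 1 / real n + 1 / real m) \<longlonglongrightarrow> 1 / of_nat n"
      using tendsto_add[OF tendsto_const lim_1_over_n, of "1 / real n"] by simp
    show "\<exists>N. \<forall>m\<ge>N. \<bar>a n / of_nat n - a m / of_nat m\<bar> \<le> 1 / of_nat n + 1 / of_nat m"
      using close[OF n] by (intro exI[of _ 1]) auto
  qed
  then have "\<bar>a n - of_nat n * transl_num F\<bar> \<le> 1"
  proof (cases "n = 0")
    case False
    then have "\<bar>a n / of_nat n - transl_num F\<bar> * of_nat n \<le> 1"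
      using \<open>n > 0 \<Longrightarrow> _\<close> by (simp add: field_simps)
    moreover have "a n - of_nat n * transl_num F = (a n / of_nat n - transl_num F) * of_nat n"
      using False by (simp add: field_simps)
    ultimately show ?thesis by (simp only: abs_mult)
  qed (simp add: a_def)
  with G_displacement[OF G_funpow[OF F], of n x 0] show ?thesis
    by (simp add: a_def)
qed

text \<open>The error in \<open>transl_num_bound\<close> is the same for all iterates, so it is
  negligible for large \<open>k\<close>. The form with multiples of \<open>n\<close> suits
  situations where only a power of \<open>F\<close> can be compared with another map.\<close>

lemma transl_num_ge:
  assumes F: "F \<in> G" and "\<And>k. (F ^^ (n * k)) x \<ge> x + of_nat k * c"
  shows "of_nat n * transl_num F \<ge> c"
proof (rule ccontr)
  assume "\<not> ?thesis"
  then have pos: "c - of_nat n * transl_num F > 0" by simp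
  then obtain k :: nat where "2 < of_nat k * (c - of_nat n * transl_num F)"
    using reals_Archimedean3 by blast
  with transl_num_bound[OF F, of "n * k" x] assms(2)[of k] show False
    by (simp add: algebra_simps)
qed

lemma transl_num_le:
  assumes F: "F \<in> G" and "\<And>k. (F ^^ (n * k)) x \<le> x + of_nat k * c"
  shows "of_nat n * transl_num F \<le> c"
proof (rule ccontr)
  assume "\<not> ?thesis"
  then have pos: "of_nat n * transl_num F - c > 0" by simp
  then obtain k :: nat where "2 < of_nat k * (of_nat n * transl_num F - c)"
    using reals_Archimedean3 by blast
  with transl_num_bound[OF F, of "n * k" x] assms(2)[of k] show False
    by (simp add: algebra_simps)
qed

lemma transl_num_ge_displacement:
  assumes F: "F \<in> G" and "\<And>x. F x \<ge> x + c"
  shows "transl_num F \<ge> c"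
proof -
  have "(F ^^ k) 0 \<ge> of_nat k * c" for k
  proof (induction k)
    case (Suc k)
    then show ?case using assms(2)[of "(F ^^ k) 0"] by (simp add: algebra_simps)
  qed simp
  then show ?thesis using transl_num_ge[OF F, where n = 1 and x = 0 and c = c] by simp
qed

lemma transl_num_le_displacement:
  assumes F: "F \<in> G" and "\<And>x. F x \<le> x + c"
  shows "transl_num F \<le> c"
proof -
  have "(F ^^ k) 0 \<le> of_nat k * c" for k
  proof (induction k)
    case (Suc k)
    then show ?case using assms(2)[of "(F ^^ k) 0"] by (simp add: algebra_simps)
  qed simp
  then show ?thesis using transl_num_le[OF F, where n = 1 and x = 0 and c = c] by simp
qed

lemma bound_from_period:
  assumes F: "F \<in> G" and P: "\<And>x. x \<in> {0..1} \<Longrightarrow> P (F x - x)"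
  shows "P (F x - x)"
proof -
  have "F x = F (frac x) + of_int \<lfloor>x\<rfloor>"
    using G_plus_int[OF F, of "frac x" "\<lfloor>x\<rfloor>"] by (simp add: frac_def)
  then have "F x - x = F (frac x) - frac x" by (simp add: frac_def)
  moreover have "frac x \<in> {0..1}" using frac_lt_1[of x] by auto
  ultimately show ?thesis using P by metis
qed

text \<open>Without fixed points the displacement has constant sign, and by compactness of a period
  it is bounded away from zero; then so is the translation number.\<close>

lemma transl_num_zero_fixpoint:
  assumes F: "F \<in> G" and t: "transl_num F = 0"
  shows "\<exists>x. F x = x"
proof (rule ccontr)
  assume no: "\<nexists>x. F x = x"
  have cont: "continuous_on S (\<lambda>x. F x - x)" for S
    by (intro continuous_intros G_continuous_on F)
  have conn: "connected (range (\<lambda>x. F x - x))"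
    using cont connected_continuous_image connected_UNIV by blast
  have ne: "{0..1::real} \<noteq> {}" "compact {0..1::real}" by auto
  have "(\<forall>x. F x - x > 0) \<or> (\<forall>x. F x - x < 0)"
  proof (rule ccontr)
    assume "\<not> ?thesis"
    then obtain x y where "F x - x \<le> 0" "F y - y \<ge> 0" by (auto simp: not_less)
    then have "0 \<in> range (\<lambda>x. F x - x)"
      using connectedD_interval[OF conn, of "F x - x" "F y - y" 0] by blast
    with no show False by (metis (no_types, lifting) eq_iff_diff_eq_0 imageE)
  qed
  then show False
  proof
    assume pos: "\<forall>x. F x - x > 0"
    obtain m where m: "m \<in> {0..1}" "\<And>y. y \<in> {0..1} \<Longrightarrow> F m - m \<le> F y - y"
      using continuous_attains_inf[OF ne(2,1) cont] by blast
    have "F x - x \<ge> F m - m" for x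
      using bound_from_period[OF F, of "\<lambda>d. F m - m \<le> d"] m(2) by blast
    then have "F x \<ge> x + (F m - m)" for x by (smt (verit))
    from transl_num_ge_displacement[OF F this] pos[rule_format, of m] t show False by simp
  next
    assume neg: "\<forall>x. F x - x < 0"
    obtain m where m: "m \<in> {0..1}" "\<And>y. y \<in> {0..1} \<Longrightarrow> F y - y \<le> F m - m"
      using continuous_attains_sup[OF ne(2,1) cont] by blast
    have "F x - x \<le> F m - m" for x
      using bound_from_period[OF F, of "\<lambda>d. d \<le> F m - m"] m(2) by blast
    then have "F x \<le> x + (F m - m)" for x by (smt (verit))
    from transl_num_le_displacement[OF F this] neg[rule_format, of m] t show False by simp
  qed
qed

section \<open>Periodic points and finite orbits\<close>

lemma transl_num_periodic:
  assumes F: "F \<in> G" and per: "(F ^^ q) z = z + of_int p"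
  shows "of_nat q * transl_num F = of_int p"
proof -
  have "(F ^^ (q * k)) z = z + of_nat k * of_int p" for k
  proof (induction k)
    case (Suc k)
    have "(F ^^ (q * Suc k)) z = (F ^^ q) ((F ^^ (q * k)) z)"
      by (simp add: funpow_add)
    also have "\<dots> = (F ^^ q) (z + of_int (of_nat k * p))" using Suc by simp
    also have "\<dots> = z + of_nat (Suc k) * of_int p"
      unfolding G_plus_int[OF G_funpow[OF F]] per by (simp add: algebra_simps)
    finally show ?case .
  qed simp
  then show ?thesis
    by (intro antisym transl_num_ge[OF F, where x = z] transl_num_le[OF F, where x = z]) auto
qed

text \<open>Pigeonhole: among the first \<open>N + 1\<close> iterates of \<open>x\<close> two agree
  modulo integers, so \<open>F\<close> has translation number \<open>p / q\<close> with
  \<open>q \<le> N\<close>. Modulo 1 this leaves only finitely many fractions.\<close>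

lemma finite_orbit_imp_finite_rot:
  assumes "has_finite_orbit G"
  shows "finite (rot_image G)"
proof -
  obtain x where fin: "finite {frac (F x) | F. F \<in> G}" (is "finite ?S")
    using assms unfolding has_finite_orbit_def by blast
  define N where "N = card ?S"
  have "rot_image G \<subseteq> (\<lambda>(r, q). of_nat r / of_nat q) ` ({..N} \<times> {..N})"
  proof
    fix t assume "t \<in> rot_image G"
    then obtain F where F: "F \<in> G" and t: "t = frac (transl_num F)"
      unfolding rot_image_def by blast
    have "(\<lambda>n. frac ((F ^^ n) x)) ` {..N} \<subseteq> ?S" using G_funpow[OF F] by blast
    then have "card ((\<lambda>n. frac ((F ^^ n) x)) ` {..N}) \<le> N"
      unfolding N_def using fin card_mono by blast
    then have "\<not> inj_on (\<lambda>n. frac ((F ^^ n) x)) {..N}"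
      using card_image by fastforce
    then obtain m n where mn: "m < n" "n \<le> N" "frac ((F ^^ m) x) = frac ((F ^^ n) x)"
      using linorder_inj_onI'[of "{..N}" "\<lambda>n. frac ((F ^^ n) x)"] by auto
    define q where "q = n - m"
    define p where "p = \<lfloor>(F ^^ n) x\<rfloor> - \<lfloor>(F ^^ m) x\<rfloor>"
    have "(F ^^ q) ((F ^^ m) x) = (F ^^ n) x"
      using mn(1) funpow_add[of q m F] by (simp add: q_def)
    also have "\<dots> = (F ^^ m) x + of_int p"
      using mn(3) by (simp add: p_def frac_def)
    finally have "of_nat q * transl_num F = of_int p"
      by (rule transl_num_periodic[OF F])
    moreover have q: "q > 0" "q \<le> N" using mn by (auto simp: q_def)
    ultimately have tau: "transl_num F = of_int p / of_nat q"
      by (simp add: field_simps)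
    have "frac (transl_num F) = of_int (p mod int q) / of_nat q"
      unfolding tau frac_def
      using floor_divide_of_int_eq[of p "int q", where ?'a = real] q(1)
      by (simp add: field_simps flip: minus_mult_div_eq_mod)
    then have "t = of_nat (nat (p mod int q)) / of_nat q"
      unfolding t using q(1) by simp
    moreover have "nat (p mod int q) \<le> N"
      using q pos_mod_bound[of "int q" p] by linarith
    ultimately show "t \<in> (\<lambda>(r, q). of_nat r / of_nat q) ` ({..N} \<times> {..N})"
      using q(2) by auto
  qed
  then show ?thesis by (rule finite_subset) auto
qed

end

section \<open>Minimal sets and contracting fixed points\<close>

context circle_group
begin

lemma finite_rot_imp_gap:
  assumes "finite (rot_image G)"
  obtains \<kappa> where "\<kappa> > 0" "\<And>F. F \<in> G \<Longrightarrow> \<bar>transl_num F\<bar> < \<kappa> \<Longrightarrow> transl_num F = 0"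
proof
  \<comment> \<open>The element 1/2 keeps \<open>A\<close> nonempty and forces
    \<open>\<kappa> \<le> 1/2\<close>. The reflections \<open>1 - t\<close> take care of small
    negative translation numbers, whose fractional parts lie just below 1.\<close>
  define A where "A = insert (1/2) (rot_image G - {0})"
  define \<kappa> where "\<kappa> = Min (A \<union> (\<lambda>t. 1 - t) ` A)"
  have fin: "finite (A \<union> (\<lambda>t. 1 - t) ` A)" using assms by (auto simp: A_def)
  have "rot_image G \<subseteq> {0..<1}"
    by (auto simp: rot_image_def frac_lt_1)
  then have "t > 0 \<and> t < 1" if "t \<in> A" for t
    using that by (force simp: A_def less_le)
  then have "\<forall>t \<in> A \<union> (\<lambda>t. 1 - t) ` A. t > 0" by auto
  then show "\<kappa> > 0" using fin by (auto simp: \<kappa>_def A_def)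
  have \<kappa>le: "\<kappa> \<le> t" "\<kappa> \<le> 1 - t" if "t \<in> A" for t
    using fin that by (auto simp: \<kappa>_def)
  show "transl_num F = 0" if F: "F \<in> G" and small: "\<bar>transl_num F\<bar> < \<kappa>" for F
  proof (rule ccontr)
    assume nz: "transl_num F \<noteq> 0"
    have half: "\<kappa> \<le> 1/2" using \<kappa>le[of "1/2"] by (simp add: A_def)
    have fr: "frac (transl_num F) = (if transl_num F > 0 then transl_num F else 1 + transl_num F)"
      using nz small half by (auto simp: frac_unique_iff frac_eq)
    then have "frac (transl_num F) \<noteq> 0" using nz small half by auto
    then have "frac (transl_num F) \<in> A"
      using F unfolding A_def rot_image_def by blast
    from \<kappa>le[OF this] fr small nz show False by (auto split: if_splits)
  qed
qed

text \<open>Zorn's lemma is applied to complements: a maximal proper invariant open set is the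
  complement of a minimal closed invariant set. The last property expresses that each orbit in the
  set is dense in it.\<close>

lemma exists_minimal_set:
  obtains K where "closed K" "K \<noteq> {}" "\<And>F x. F \<in> G \<Longrightarrow> x \<in> K \<Longrightarrow> F x \<in> K"
    "\<And>z u v. z \<in> K \<Longrightarrow> K \<inter> {u<..<v} \<noteq> {} \<Longrightarrow> \<exists>F\<in>G. F z \<in> {u<..<v}"
proof -
  define A where "A = {U. open U \<and> U \<noteq> UNIV \<and> (\<forall>F\<in>G. \<forall>x\<in>U. F x \<in> U)}"
  have "\<exists>M\<in>A. \<forall>X\<in>A. M \<subseteq> X \<longrightarrow> X = M"
  proof (rule subset_Zorn_nonempty)
    show "A \<noteq> {}" by (auto simp: A_def)
    fix C assume C: "C \<noteq> {}" "subset.chain A C"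
    have sub: "C \<subseteq> A" using C(2) by (auto simp: subset.chain_def)
    \<comment> \<open>If the chain covered the line, then by compactness one of its members would
      contain a period and, being invariant under integer translations, the whole line.\<close>
    have "\<Union>C \<noteq> UNIV"
    proof
      assume "\<Union>C = UNIV"
      then obtain D where D: "D \<subseteq> C" "finite D" "{0..1} \<subseteq> \<Union>D"
        using compactE[of "{0..1::real}" C] sub by (auto simp: A_def)
      have "D \<noteq> {}" using D(3) by auto
      then have "\<Union>D \<in> D"
        using D(1,2) C(2) by (intro Union_in_chain[of D A]) (unfold subset_chain_def, blast+)
      then have UD: "\<Union>D \<in> A" using D(1) sub by blast
      have "x \<in> \<Union>D" for x :: real
      proof -
        have "frac x \<in> \<Union>D"
          using D(3) frac_lt_1[of x] frac_ge_0[of x] by (meson atLeastAtMost_iff less_imp_le subsetD)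
        moreover have "\<forall>F\<in>G. \<forall>x\<in>\<Union>D. F x \<in> \<Union>D" using UD by (auto simp only: A_def mem_Collect_eq)
        ultimately have "frac x + of_int \<lfloor>x\<rfloor> \<in> \<Union>D"
          using G_translation[of "\<lfloor>x\<rfloor>"] by fast
        then show ?thesis by (simp add: frac_def)
      qed
      then have "\<Union>D = UNIV" by blast
      then show False using UD by (simp add: A_def)
    qed
    moreover have "open (\<Union>C)" using sub by (auto simp: A_def)
    moreover have "F x \<in> \<Union>C" if "F \<in> G" "x \<in> \<Union>C" for F x
    proof -
      from that obtain U where "U \<in> C" "x \<in> U" by blast
      moreover then have "F x \<in> U" using sub that(1) by (auto simp: A_def)
      ultimately show ?thesis by blast
    qed
    ultimately show "\<Union>C \<in> A" by (simp add: A_def)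
  qed
  then obtain M where M: "M \<in> A" "\<And>X. X \<in> A \<Longrightarrow> M \<subseteq> X \<Longrightarrow> X = M" by blast
  show ?thesis
  proof
    show "closed (- M)" "- M \<noteq> {}" using M(1) by (auto simp: A_def closed_def)
    show inv: "F x \<in> - M" if "F \<in> G" "x \<in> - M" for F x
    proof
      assume "F x \<in> M"
      then have "inv F (F x) \<in> M" using M(1) G_inv[OF that(1)] by (auto simp: A_def)
      with that show False by (simp add: G_inv_left)
    qed
    fix z u v assume z: "z \<in> - M" and uv: "- M \<inter> {u<..<v} \<noteq> {}"
    show "\<exists>F\<in>G. F z \<in> {u<..<v}"
    proof (rule ccontr)
      assume no: "\<not> ?thesis"
      \<comment> \<open>Adjoining all points whose orbit meets the interval gives an invariant open
        set that still misses \<open>z\<close>, so maximality leaves no room for it.\<close>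
      define X where "X = M \<union> (\<Union>F\<in>G. F -` {u<..<v})"
      have "open X"
        unfolding X_def using M(1)
        by (intro open_Un open_UN ballI continuous_open_vimage G_isCont) (auto simp: A_def)
      moreover have "z \<notin> X" using z no by (auto simp: X_def)
      moreover have "F x \<in> X" if F: "F \<in> G" and x: "x \<in> X" for F x
      proof (cases "x \<in> M")
        case True
        then show ?thesis using M(1) F by (auto simp: X_def A_def)
      next
        case False
        then obtain H where H: "H \<in> G" "H x \<in> {u<..<v}" using x by (auto simp: X_def)
        then have "H \<circ> inv F \<in> G" "(H \<circ> inv F) (F x) \<in> {u<..<v}"
          using F by (auto simp: G_comp G_inv G_inv_left)
        then show ?thesis unfolding X_def by blast
      qed
      ultimately have "X \<in> A" by (auto simp: A_def)
      then have "X = M" using M(2) by (auto simp: X_def)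
      moreover have "{u<..<v} \<subseteq> X" using G_id by (force simp: X_def)
      ultimately show False using uv by auto
    qed
  qed
qed

section \<open>Isolated fixed points and one-sided contractions\<close>

lemma fixpoints_not_limpt:
  assumes F: "F \<in> G" and ne: "F x \<noteq> x"
  shows "\<not> z islimpt {x. F x = x}"
  using real_analytic_limpt_zeros[OF real_analytic_diff_id[OF G_analytic[OF F]], of z x] ne by auto

lemma iterates_tendsto_fixpoint:
  assumes f: "f \<in> G" "f c = c" "\<And>x. x \<in> {c<..d} \<Longrightarrow> f x < x" and x: "x \<in> {c<..d}"
  shows "(\<lambda>k. (f ^^ k) x) \<longlonglongrightarrow> c" "(f ^^ k) x \<in> {c<..x}" "decseq (\<lambda>k. (f ^^ k) x)"
proof -
  have step: "f y \<in> {c<..x}" if "y \<in> {c<..x}" for y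
    using that f(3)[of y] x G_less[OF f(1), of c y] f(2) by auto
  show mem: "(f ^^ k) x \<in> {c<..x}" for k
    using x by (induction k) (use step in auto)
  have dec: "(f ^^ Suc k) x \<le> (f ^^ k) x" for k
    using mem[of k] f(3)[of "(f ^^ k) x"] x by auto
  then show "decseq (\<lambda>k. (f ^^ k) x)" by (rule decseq_SucI)
  moreover have "\<forall>i. c \<le> (f ^^ i) x" using mem by (simp add: less_imp_le)
  ultimately obtain L where L: "(\<lambda>k. (f ^^ k) x) \<longlonglongrightarrow> L" "\<forall>i. L \<le> (f ^^ i) x"
    using decseq_convergent by blast
  have "(\<lambda>k. f ((f ^^ k) x)) \<longlonglongrightarrow> f L"
    using G_isCont[OF f(1), of L] L(1) by (rule isCont_tendsto_compose)
  moreover have "(\<lambda>k. f ((f ^^ k) x)) \<longlonglongrightarrow> L"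
    using LIMSEQ_Suc[OF L(1)] by simp
  ultimately have "f L = L" using LIMSEQ_unique by blast
  moreover have "c \<le> L" by (rule LIMSEQ_le_const[OF L(1)]) (use mem in \<open>auto simp: less_imp_le\<close>)
  moreover have "L \<le> d" using L(2) mem[of 0] x by (auto dest: spec[of _ 0])
  ultimately have "L = c" using f(3)[of L] by force
  with L(1) show "(\<lambda>k. (f ^^ k) x) \<longlonglongrightarrow> c" by simp
qed

text \<open>Without finite orbits \<open>K\<close> has infinitely many points in a period, while
  fixed points of \<open>g\<close> do not accumulate; so \<open>g\<close> moves some
  \<open>z\<close> in \<open>K\<close>. The last fixed point \<open>c\<close> before
  \<open>z\<close> attracts \<open>z\<close> under \<open>g\<close> or its inverse, and as a limit
  of points of \<open>K\<close> it lies in \<open>K\<close>.\<close>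

lemma contracting_fixpoint:
  assumes g: "g \<in> G" "g w = w" "\<not> lifts_identity g"
    and nofin: "\<not> has_finite_orbit G"
    and K: "closed K" "K \<noteq> {}" "\<And>F x. F \<in> G \<Longrightarrow> x \<in> K \<Longrightarrow> F x \<in> K"
  obtains f c d where "f \<in> G" "f c = c" "c < d" "\<And>x. x \<in> {c<..d} \<Longrightarrow> f x < x" "c \<in> K" "d \<in> K"
proof -
  obtain z0 where z0: "z0 \<in> K" using K(2) by blast
  obtain y where y: "g y \<noteq> y"
    using g(3) unfolding lifts_identity_def by (metis add.right_neutral of_int_0)
  have inf: "infinite (K \<inter> {0..1})"
  proof
    assume "finite (K \<inter> {0..1})"
    moreover have "{frac (F z0) | F. F \<in> G} \<subseteq> K \<inter> {0..1}"
    proof clarify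
      fix F assume F: "F \<in> G"
      have "frac (F z0) = F z0 + of_int (- \<lfloor>F z0\<rfloor>)" by (simp add: frac_def)
      then have "frac (F z0) \<in> K"
        using K(3)[OF G_translation K(3)[OF F z0], of "- \<lfloor>F z0\<rfloor>"] by simp
      then show "frac (F z0) \<in> K \<inter> {0..1}" using frac_lt_1[of "F z0"] by auto
    qed
    ultimately have "finite {frac (F z0) | F. F \<in> G}" by (rule rev_finite_subset)
    then show False using nofin by (auto simp: has_finite_orbit_def)
  qed
  then obtain l where l: "l islimpt (K \<inter> {0..1})"
    using Heine_Borel_imp_Bolzano_Weierstrass[of "{0..1}" "K \<inter> {0..1}"] by auto
  obtain z where z: "z \<in> K" "g z \<noteq> z"
    using islimpt_subset[OF l, of "{x. g x = x}"] fixpoints_not_limpt[OF g(1) y] by blast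
  define Fx where "Fx = {x. g x = x} \<inter> {..z}"
  have clo: "closed Fx"
    unfolding Fx_def
    using closed_Collect_eq[OF G_continuous_on[OF g(1)] continuous_on_id] by (intro closed_Int) auto
  \<comment> \<open>An integer translate of \<open>w\<close> is a fixed point at or before
    \<open>z\<close>, which makes the set of candidates for \<open>c\<close> nonempty.\<close>
  have "w + of_int \<lfloor>z - w\<rfloor> \<in> Fx"
    using G_plus_int[OF g(1), of w "\<lfloor>z - w\<rfloor>"] g(2) by (auto simp: Fx_def) linarith
  then have ne: "Fx \<noteq> {}" by blast
  have bdd: "bdd_above Fx" by (auto simp: Fx_def bdd_above_def)
  define c where "c = Sup Fx"
  have "c \<in> Fx" unfolding c_def by (rule closed_contains_Sup[OF ne bdd clo])
  then have c: "g c = c" "c < z" using z(2) by (auto simp: Fx_def less_le)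
  have nofix: "g x \<noteq> x" if "x \<in> {c<..z}" for x
    using cSup_upper[OF _ bdd, of x] that by (auto simp: Fx_def c_def)
  have cont: "continuous_on S (\<lambda>x. g x - x)" for S
    by (intro continuous_intros G_continuous_on g)
  have conn: "connected ((\<lambda>x. g x - x) ` {c<..z})"
    by (intro connected_continuous_image cont) auto
  have "\<exists>f\<in>G. f c = c \<and> (\<forall>x\<in>{c<..z}. f x < x)"
  proof (cases "g z < z")
    case True
    have "g x < x" if x: "x \<in> {c<..z}" for x
    proof (rule ccontr)
      assume "\<not> g x < x"
      then have "0 \<in> (\<lambda>x. g x - x) ` {c<..z}"
        using connectedD_interval[OF conn, of "g z - z" "g x - x" 0] x True c by auto
      then show False using nofix by auto
    qed
    then show ?thesis using c g by blast
  next
    case False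
    have gt: "g x > x" if x: "x \<in> {c<..z}" for x
    proof (rule ccontr)
      assume "\<not> g x > x"
      then have "0 \<in> (\<lambda>x. g x - x) ` {c<..z}"
        using connectedD_interval[OF conn, of "g x - x" "g z - z" 0] x False c by auto
      then show False using nofix by auto
    qed
    have "inv g x < x" if x: "x \<in> {c<..z}" for x
      using G_less[OF G_inv[OF g(1)], of x "g x"] gt[OF x] by (simp add: G_inv_left[OF g(1)])
    moreover have "inv g c = c" using G_inv_left[OF g(1), of c] c by simp
    ultimately show ?thesis using G_inv[OF g(1)] by blast
  qed
  then obtain f where f: "f \<in> G" "f c = c" "\<And>x. x \<in> {c<..z} \<Longrightarrow> f x < x" by blast
  have "(\<lambda>k. (f ^^ k) z) \<longlonglongrightarrow> c"
    using iterates_tendsto_fixpoint[OF f, of z] c by auto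
  from closed_sequentially[OF K(1) K(3)[OF G_funpow[OF f(1)] z(1)] this] have "c \<in> K" .
  then show thesis using that[of f c z] f c z by blast
qed

end

section \<open>Zooming in at a contracting fixed point\<close>

lemma abs_ln_le:
  fixes t :: real assumes "\<bar>t - 1\<bar> \<le> 1/2" shows "\<bar>ln t\<bar> \<le> 2 * \<bar>t - 1\<bar>"
proof -
  have t: "t \<ge> 1/2" using assms by linarith
  have "ln t \<le> t - 1" using t by (intro ln_le_minus_one) auto
  also have "\<dots> \<le> 2 * \<bar>t - 1\<bar>" by (simp add: abs_if)
  finally have "ln t \<le> 2 * \<bar>t - 1\<bar>" .
  moreover have "- ln t \<le> 2 * \<bar>t - 1\<bar>"
  proof -
    have "- ln t \<le> 1 / t - 1"
      using ln_le_minus_one[of "1 / t"] t by (simp add: ln_div)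
    also have "\<dots> = (1 - t) / t" using t by (simp add: field_simps)
    also have "\<dots> \<le> \<bar>t - 1\<bar> / (1/2)" using t by (intro frac_le) auto
    finally show ?thesis by simp
  qed
  ultimately show ?thesis by (rule abs_leI)
qed

lemma abs_exp_minus_1_le:
  fixes s :: real assumes "\<bar>s\<bar> \<le> 1" shows "\<bar>exp s - 1\<bar> \<le> 2 * \<bar>s\<bar>"
proof (cases "s \<ge> 0")
  case True
  then have "exp s \<le> 1 + s + s\<^sup>2" using assms by (intro exp_bound) auto
  moreover have "s\<^sup>2 \<le> s" using True assms by (simp add: power2_eq_square mult_left_le)
  ultimately show ?thesis using True exp_ge_add_one_self[of s] by linarith
next
  case False
  then show ?thesis using exp_ge_add_one_self[of s] exp_less_one_iff[of s] by linarith
qed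

context circle_group
begin

lemma G_deriv_comp:
  assumes "F \<in> G" "H \<in> G"
  shows "deriv (F \<circ> H) x = deriv F (H x) * deriv H x"
  using DERIV_chain[OF G_deriv[OF assms(1)] G_deriv[OF assms(2)]] by (rule DERIV_imp_deriv)

text \<open>Logarithms make the chain rule additive, so distortion along long compositions becomes a
  sum.\<close>

lemma ln_deriv_comp:
  assumes "F \<in> G" "H \<in> G"
  shows "ln (deriv (F \<circ> H) x) = ln (deriv F (H x)) + ln (deriv H x)"
  using G_deriv_pos[OF assms(1), of "H x"] G_deriv_pos[OF assms(2), of x]
  by (simp add: G_deriv_comp assms ln_mult)

lemma ln_deriv_inv:
  assumes F: "F \<in> G"
  shows "ln (deriv (inv F) x) = - ln (deriv F (inv F x))"
proof -
  have "F \<circ> inv F = (\<lambda>x. x)" using G_inv_right[OF F] by auto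
  then show ?thesis using ln_deriv_comp[OF F G_inv[OF F], of x] by simp
qed

lemma G_mvt:
  assumes F: "F \<in> G" and "u < v"
  obtains \<xi> where "u < \<xi>" "\<xi> < v" "F v - F u = (v - u) * deriv F \<xi>"
  using MVT2[OF assms(2), of F "deriv F"] G_deriv[OF F] by blast

text \<open>Mean value theorem for \<open>g x - x\<close>, whose derivative is
  \<open>deriv g x - 1\<close>: C1-smallness keeps the displacement nearly constant on short
  intervals.\<close>

lemma displacement_lipschitz:
  assumes g: "g \<in> G" and e: "e \<le> 1" and S: "\<And>x. x \<in> {a..b} \<Longrightarrow> \<bar>ln (deriv g x)\<bar> \<le> e"
    and xy: "x \<in> {a..b}" "y \<in> {a..b}"
  shows "\<bar>(g x - x) - (g y - y)\<bar> \<le> 2 * e * \<bar>x - y\<bar>"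
proof -
  have main: "\<bar>(g v - v) - (g u - u)\<bar> \<le> 2 * e * (v - u)" if uv: "u < v" "u \<in> {a..b}" "v \<in> {a..b}" for u v
  proof -
    obtain \<xi> where \<xi>: "u < \<xi>" "\<xi> < v" "g v - g u = (v - u) * deriv g \<xi>"
      using G_mvt[OF g uv(1)] .
    have s: "\<bar>ln (deriv g \<xi>)\<bar> \<le> e" using S[of \<xi>] \<xi> uv by auto
    have "\<bar>deriv g \<xi> - 1\<bar> \<le> 2 * e"
      using abs_exp_minus_1_le[of "ln (deriv g \<xi>)"] s e G_deriv_pos[OF g, of \<xi>] by simp
    moreover have "(g v - v) - (g u - u) = (v - u) * (deriv g \<xi> - 1)"
      using \<xi>(3) by (simp add: algebra_simps)
    ultimately show ?thesis using uv(1)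
      by (simp add: abs_mult mult.commute mult_left_mono)
  qed
  show ?thesis
    using main[of x y] main[of y x] xy by (cases x y rule: linorder_cases) (auto simp: abs_minus_commute)
qed

text \<open>The derivative of \<open>ln (deriv F)\<close> is continuous by analyticity, hence
  bounded on a compact interval.\<close>

lemma ln_deriv_lipschitz:
  assumes F: "F \<in> G"
  obtains L where "L \<ge> 0" "\<And>x y. x \<in> {a..b} \<Longrightarrow> y \<in> {a..b} \<Longrightarrow> \<bar>ln (deriv F x) - ln (deriv F y)\<bar> \<le> L * \<bar>x - y\<bar>"
proof -
  have an: "real_analytic (deriv F)" by (rule real_analytic_has_deriv(2)[OF G_analytic[OF F]])
  have D: "((\<lambda>x. ln (deriv F x)) has_real_derivative deriv (deriv F) x / deriv F x) (at x)" for x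
    using DERIV_chain2[OF DERIV_ln_divide[OF G_deriv_pos[OF F]] real_analytic_has_deriv(1)[OF an], of x]
    by simp
  have "continuous_on {a..b} (\<lambda>x. deriv (deriv F) x / deriv F x)"
    using real_analytic_has_deriv(1)[OF real_analytic_has_deriv(2)[OF an]] G_deriv_pos[OF F]
    by (intro continuous_intros G_deriv_continuous_on F continuous_at_imp_continuous_on)
      (auto intro: DERIV_isCont simp: less_imp_neq[symmetric])
  then have "compact ((\<lambda>x. deriv (deriv F) x / deriv F x) ` {a..b})"
    by (rule compact_continuous_image) auto
  then have "bounded ((\<lambda>x. deriv (deriv F) x / deriv F x) ` {a..b})"
    by (rule compact_imp_bounded)
  then obtain L where L: "L > 0" "\<And>x. x \<in> {a..b} \<Longrightarrow> norm (deriv (deriv F) x / deriv F x) \<le> L"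
    unfolding bounded_pos by auto
  show thesis
  proof
    show "L \<ge> 0" using L by simp
    fix x y assume "x \<in> {a..b}" "y \<in> {a..b}"
    then show "\<bar>ln (deriv F x) - ln (deriv F y)\<bar> \<le> L * \<bar>x - y\<bar>"
      using field_differentiable_bound[of "{a..b}" "\<lambda>x. ln (deriv F x)" "\<lambda>x. deriv (deriv F) x / deriv F x" L x y] L(2)
        has_field_derivative_at_within[OF D]
      by auto
  qed
qed

end

text \<open>The map \<open>h\<close> carries the fixed point \<open>c\<close> into the interior of a
  fundamental domain of \<open>f\<close>. Through \<open>h\<close>, an element that moves a point of
  that domain becomes one that moves \<open>c\<close>.\<close>

locale contraction = circle_group +
  fixes f h :: "real \<Rightarrow> real" and c d :: real
  assumes f: "f \<in> G" and fc: "f c = c" and cd: "c < d" and f_less: "\<And>x. x \<in> {c<..d} \<Longrightarrow> f x < x"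
    and h: "h \<in> G" and hc: "(f ^^ 2) d < h c" "h c < (f ^^ 1) d"
begin

definition y where "y k = (f ^^ k) d"

text \<open>A fundamental domain of \<open>f\<close>; \<open>D'\<close> adds one more on each side,
  as room for points displaced out of \<open>D\<close>.\<close>

abbreviation D where "D \<equiv> {y 2..y 1}"
abbreviation D' where "D' \<equiv> {y 3..y 0}"

lemma fk: "f ^^ k \<in> G" by (rule G_funpow[OF f])

lemma fk_y: "(f ^^ k) (y n) = y (n + k)"
  by (simp add: y_def add.commute funpow_add)

lemma y_tendsto: "y \<longlonglongrightarrow> c" and y_mem: "y k \<in> {c<..d}" and y_decseq: "decseq y"
proof -
  have d: "d \<in> {c<..d}" using cd by simp
  show "y \<longlonglongrightarrow> c" using iterates_tendsto_fixpoint(1)[OF f fc f_less d] unfolding y_def[abs_def] .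
  show "y k \<in> {c<..d}" using iterates_tendsto_fixpoint(2)[OF f fc f_less d] by (simp add: y_def)
  show "decseq y" using iterates_tendsto_fixpoint(3)[OF f fc f_less d] unfolding y_def[abs_def] .
qed

lemma y_Suc: "y (Suc k) = f (y k)" and y_0: "y 0 = d"
  by (simp_all add: y_def)

lemma y_less: "y (Suc k) < y k"
  using f_less[OF y_mem[of k]] by (simp add: y_Suc)

lemma y_antimono: "m \<le> n \<Longrightarrow> y n \<le> y m"
  using y_decseq by (simp add: decseq_def)

lemma y_order: "y 3 < y 2" "y 2 < y 1" "y 1 < y 0"
  using y_less[of 0] y_less[of 1] y_less[of 2] by (simp_all add: numeral_eq_Suc)

lemma D_subset: "D \<subseteq> D'" "D' \<subseteq> {c<..d}"
  using y_order y_mem[of 3] y_0 by auto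

section \<open>Images of the fundamental domains and bounded distortion\<close>

lemma fk_D': "u \<in> D' \<Longrightarrow> (f ^^ k) u \<in> {y (k + 3)..y k}"
  using G_le[OF fk, of k "y 3" u] G_le[OF fk, of k u "y 0"] by (simp add: fk_y add.commute)

lemma fk_D: "u \<in> D \<Longrightarrow> (f ^^ k) u \<in> {y (k + 2)..y (k + 1)}"
  using G_le[OF fk, of k "y 2" u] G_le[OF fk, of k u "y 1"] by (simp add: fk_y add.commute)

text \<open>The sum telescopes with shift 3, leaving three terms at each end, all between
  \<open>c\<close> and \<open>d\<close>.\<close>

lemma sum_lengths: "(\<Sum>i<k. y i - y (i + 3)) \<le> 3 * (d - c)"
proof -
  have "(\<Sum>i<k. y i - y (i + 3)) + y k + y (k + 1) + y (k + 2) = y 0 + y 1 + y 2"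
    by (induction k) (auto simp: numeral_eq_Suc)
  moreover have "y i > c" "y i \<le> d" for i using y_mem[of i] by auto
  from this(1)[of k] this(1)[of "k+1"] this(1)[of "k+2"] this(2)[of 0] this(2)[of 1] this(2)[of 2]
  have "y k > c" "y (k+1) > c" "y (k+2) > c" "y 0 \<le> d" "y 1 \<le> d" "y 2 \<le> d" .
  ultimately show ?thesis by argo
qed

definition L where "L = (SOME L. L \<ge> 0 \<and> (\<forall>x\<in>{c..d}. \<forall>z\<in>{c..d}. \<bar>ln (deriv f x) - ln (deriv f z)\<bar> \<le> L * \<bar>x - z\<bar>))"

lemma L: "L \<ge> 0" "x \<in> {c..d} \<Longrightarrow> z \<in> {c..d} \<Longrightarrow> \<bar>ln (deriv f x) - ln (deriv f z)\<bar> \<le> L * \<bar>x - z\<bar>"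
proof -
  have "\<exists>L. L \<ge> 0 \<and> (\<forall>x\<in>{c..d}. \<forall>z\<in>{c..d}. \<bar>ln (deriv f x) - ln (deriv f z)\<bar> \<le> L * \<bar>x - z\<bar>)"
    using ln_deriv_lipschitz[OF f, of c d] by metis
  from someI_ex[OF this, folded L_def] show "L \<ge> 0" 
    "x \<in> {c..d} \<Longrightarrow> z \<in> {c..d} \<Longrightarrow> \<bar>ln (deriv f x) - ln (deriv f z)\<bar> \<le> L * \<bar>x - z\<bar>" by blast+
qed

text \<open>The chain rule expands both logarithms along the two orbits, and \<open>L\<close> is a
  Lipschitz constant of \<open>ln (deriv f)\<close>.\<close>

lemma ln_deriv_fk_diff:
  assumes u: "u \<in> D'" and v: "v \<in> D'"
  shows "\<bar>ln (deriv (f ^^ k) u) - ln (deriv (f ^^ k) v)\<bar> \<le> L * (\<Sum>i<k. \<bar>(f ^^ i) u - (f ^^ i) v\<bar>)"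
proof (induction k)
  case (Suc k)
  have "(f ^^ k) u \<in> {c..d}" "(f ^^ k) v \<in> {c..d}"
    using fk_D'[OF u, of k] fk_D'[OF v, of k] y_mem[of k] y_mem[of "k+3"] by auto
  from L(2)[OF this] Suc show ?case
    unfolding funpow.simps(2) ln_deriv_comp[OF f fk] by (simp add: distrib_left)
qed (simp add: id_def)

definition E where "E = exp (3 * L * (d - c))"

lemma E: "E \<ge> 1" using L(1) cd by (simp add: E_def)

text \<open>Classical bounded distortion: the total length of the images of \<open>D'\<close> is
  bounded by \<open>sum_lengths\<close>, so the constant does not depend on
  \<open>k\<close>.\<close>

lemma deriv_fk_ratio:
  assumes u: "u \<in> D'" and v: "v \<in> D'"
  shows "deriv (f ^^ k) u \<le> E * deriv (f ^^ k) v"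
proof -
  have "(\<Sum>i<k. \<bar>(f ^^ i) u - (f ^^ i) v\<bar>) \<le> (\<Sum>i<k. y i - y (i + 3))"
  proof (rule sum_mono)
    fix i show "\<bar>(f ^^ i) u - (f ^^ i) v\<bar> \<le> y i - y (i + 3)"
      using fk_D'[OF u, of i] fk_D'[OF v, of i] by auto
  qed
  also have "\<dots> \<le> 3 * (d - c)" by (rule sum_lengths)
  finally have "L * (\<Sum>i<k. \<bar>(f ^^ i) u - (f ^^ i) v\<bar>) \<le> L * (3 * (d - c))"
    using L(1) by (rule mult_left_mono)
  with ln_deriv_fk_diff[OF u v, of k]
  have "ln (deriv (f ^^ k) u) \<le> 3 * L * (d - c) + ln (deriv (f ^^ k) v)" by (simp add: algebra_simps)
  then have "exp (ln (deriv (f ^^ k) u)) \<le> exp (3 * L * (d - c) + ln (deriv (f ^^ k) v))" by simp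
  then show ?thesis
    using G_deriv_pos[OF fk, of k] by (simp add: E_def exp_add)
qed

definition H where "H = y 0 - y 3"

lemma H: "H > 0" using y_order by (simp add: H_def)

text \<open>By the mean value theorem, the slope of \<open>f ^^ k\<close> between two points of
  \<open>D'\<close> differs at most by the factor \<open>E\<close> from its mean slope
  \<open>(y k - y (k + 3)) / H\<close> on all of \<open>D'\<close>.\<close>

lemma distortion:
  assumes u: "u \<in> D'" and v: "v \<in> D'"
  shows "\<bar>(f ^^ k) u - (f ^^ k) v\<bar> \<le> E * \<bar>u - v\<bar> / H * (y k - y (k + 3))"
    and "\<bar>u - v\<bar> / (E * H) * (y k - y (k + 3)) \<le> \<bar>(f ^^ k) u - (f ^^ k) v\<bar>"
proof -
  have *: "(f ^^ k) v - (f ^^ k) u \<le> E * (v - u) / H * (y k - y (k + 3)) \<and>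
     (v - u) / (E * H) * (y k - y (k + 3)) \<le> (f ^^ k) v - (f ^^ k) u"
    if u: "u \<in> D'" and v: "v \<in> D'" and uv: "u < v" for u v
  proof -
    obtain \<xi> where \<xi>: "u < \<xi>" "\<xi> < v" "(f ^^ k) v - (f ^^ k) u = (v - u) * deriv (f ^^ k) \<xi>"
      using G_mvt[OF fk uv] .
    obtain \<zeta> where \<zeta>: "y 3 < \<zeta>" "\<zeta> < y 0" "(f ^^ k) (y 0) - (f ^^ k) (y 3) = H * deriv (f ^^ k) \<zeta>"
      using G_mvt[OF fk, of "y 3" "y 0"] y_order unfolding H_def by auto
    have mem: "\<xi> \<in> D'" "\<zeta> \<in> D'" using \<xi> \<zeta> u v by auto
    have len: "y k - y (k + 3) = H * deriv (f ^^ k) \<zeta>"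
      using \<zeta>(3) fk_y[of k] by (simp add: add.commute)
    have "(v - u) * deriv (f ^^ k) \<xi> \<le> (v - u) * (E * deriv (f ^^ k) \<zeta>)"
      using deriv_fk_ratio[OF mem] uv by (intro mult_left_mono) auto
    moreover have "(v - u) * deriv (f ^^ k) \<zeta> \<le> (v - u) * (E * deriv (f ^^ k) \<xi>)"
      using deriv_fk_ratio[OF mem(2,1)] uv by (intro mult_left_mono) auto
    moreover have "E * (v - u) / H * (H * deriv (f ^^ k) \<zeta>) = (v - u) * (E * deriv (f ^^ k) \<zeta>)"
      using H by simp
    moreover have "(v - u) / (E * H) * (H * deriv (f ^^ k) \<zeta>) = (v - u) * deriv (f ^^ k) \<zeta> / E"
      using H by simp
    ultimately show ?thesis
      unfolding \<xi>(3) len using E by (simp add: pos_divide_le_eq mult_ac)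
  qed
  have mono: "u < v \<Longrightarrow> (f ^^ k) u < (f ^^ k) v" for u v using G_less[OF fk] by blast
  show "\<bar>(f ^^ k) u - (f ^^ k) v\<bar> \<le> E * \<bar>u - v\<bar> / H * (y k - y (k + 3))"
    using *[OF u v] *[OF v u] mono[of u v] mono[of v u] by (cases u v rule: linorder_cases) auto
  show "\<bar>u - v\<bar> / (E * H) * (y k - y (k + 3)) \<le> \<bar>(f ^^ k) u - (f ^^ k) v\<bar>"
    using *[OF u v] *[OF v u] mono[of u v] mono[of v u] by (cases u v rule: linorder_cases) auto
qed

section \<open>Conjugation by powers of the contraction\<close>

definition margin where "margin = min (y 2 - y 3) (y 0 - y 1)"

lemma margin: "margin > 0" using y_order by (simp add: margin_def)

lemma D_margin: "u \<in> D \<Longrightarrow> \<bar>v - u\<bar> \<le> margin \<Longrightarrow> v \<in> D'"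
  using margin_def by auto

text \<open>The room \<open>margin\<close> around \<open>D\<close> inside \<open>D'\<close> keeps,
  by bounded distortion, at least the proportion \<open>margin / (E * H)\<close> of the image of
  \<open>D'\<close>, so \<open>w\<close> stays in that image. Only then can the lower distortion
  bound be applied to the preimage of \<open>w\<close>.\<close>

lemma displaced_preimage:
  assumes u: "u \<in> D" and w: "\<bar>w - (f ^^ k) u\<bar> \<le> q * (y k - y (k + 3))" and q: "q \<le> margin / (E * H)"
  shows "inv (f ^^ k) w \<in> D'" "\<bar>inv (f ^^ k) w - u\<bar> \<le> E * H * q"
proof -
  define v where "v = inv (f ^^ k) w"
  define \<Lambda> where "\<Lambda> = y k - y (k + 3)"
  have w_eq: "w = (f ^^ k) v" unfolding v_def using G_inv_right[OF fk] by simp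
  have EH: "E * H > 0" using E H by simp
  have \<Lambda>: "\<Lambda> > 0"
    unfolding \<Lambda>_def using y_less[of k] y_antimono[of "Suc k" "k + 3"] by simp
  have u': "u \<in> D'" using u D_subset by blast
  have ends: "y 3 \<in> D'" "y 0 \<in> D'" using y_order by auto
  have marg: "q * \<Lambda> \<le> margin / (E * H) * \<Lambda>" using q \<Lambda> by (intro mult_right_mono) auto
  have "margin / (E * H) * \<Lambda> \<le> \<bar>u - y 3\<bar> / (E * H) * \<Lambda>"
    using u \<Lambda> EH by (intro mult_right_mono divide_right_mono) (auto simp: margin_def)
  also have "\<dots> \<le> \<bar>(f ^^ k) u - (f ^^ k) (y 3)\<bar>"
    unfolding \<Lambda>_def by (rule distortion(2)[OF u' ends(1)])
  also have "\<dots> = (f ^^ k) u - (f ^^ k) (y 3)"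
    using u' G_le[OF fk, of k "y 3" u] by auto
  finally have "(f ^^ k) (y 3) \<le> w" using w marg unfolding \<Lambda>_def[symmetric] by linarith
  then have lo: "y 3 \<le> v" unfolding w_eq using G_le[OF fk] by blast
  have "margin / (E * H) * \<Lambda> \<le> \<bar>u - y 0\<bar> / (E * H) * \<Lambda>"
    using u \<Lambda> EH by (intro mult_right_mono divide_right_mono) (auto simp: margin_def)
  also have "\<dots> \<le> \<bar>(f ^^ k) u - (f ^^ k) (y 0)\<bar>"
    unfolding \<Lambda>_def by (rule distortion(2)[OF u' ends(2)])
  also have "\<dots> = (f ^^ k) (y 0) - (f ^^ k) u"
    using u' G_le[OF fk, of k u "y 0"] by auto
  finally have "w \<le> (f ^^ k) (y 0)" using w marg unfolding \<Lambda>_def[symmetric] by linarith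
  then have hi: "v \<le> y 0" unfolding w_eq using G_le[OF fk] by blast
  show v: "inv (f ^^ k) w \<in> D'" using lo hi by (simp add: v_def)
  have "\<bar>v - u\<bar> / (E * H) * \<Lambda> \<le> \<bar>(f ^^ k) v - (f ^^ k) u\<bar>"
    unfolding \<Lambda>_def using v u' by (intro distortion(2)) (auto simp: v_def)
  also have "\<dots> \<le> q * \<Lambda>" using w unfolding w_eq \<Lambda>_def .
  finally have "\<bar>v - u\<bar> / (E * H) \<le> q" using \<Lambda> mult_le_cancel_right_pos by blast
  then show "\<bar>inv (f ^^ k) w - u\<bar> \<le> E * H * q"
    unfolding v_def[symmetric] using EH by (simp add: pos_divide_le_eq mult.commute)
qed

text \<open>The two natural scales at depth \<open>k\<close>, the fundamental domain ending at the
  iterate of \<open>\<xi>\<close> and the image of \<open>D'\<close>, agree up to factors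
  independent of \<open>k\<close>.\<close>

lemma fundamental_length:
  assumes "\<xi> \<in> D"
  shows "(f ^^ k) \<xi> - f ((f ^^ k) \<xi>) \<le> y k - y (k + 3)"
    and "(f ^^ k) \<xi> - f ((f ^^ k) \<xi>) \<ge> (\<xi> - f \<xi>) / (E * H) * (y k - y (k + 3))"
proof -
  have f\<xi>: "f \<xi> \<in> {y 3..y 2}"
    using assms G_le[OF f, of "y 2" \<xi>] G_le[OF f, of \<xi> "y 1"] y_Suc[of 1] y_Suc[of 2]
    by (simp add: numeral_eq_Suc)
  then have mem: "\<xi> \<in> D'" "f \<xi> \<in> D'" using assms y_order by auto
  have comm: "f ((f ^^ k) \<xi>) = (f ^^ k) (f \<xi>)" by (simp add: funpow_swap1)
  show "(f ^^ k) \<xi> - f ((f ^^ k) \<xi>) \<le> y k - y (k + 3)"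
    unfolding comm using fk_D'[OF mem(1), of k] fk_D'[OF mem(2), of k] by auto
  have le: "f \<xi> \<le> \<xi>" using f\<xi> assms by auto
  then have "(f ^^ k) (f \<xi>) \<le> (f ^^ k) \<xi>" using G_le[OF fk] by blast
  then show "(f ^^ k) \<xi> - f ((f ^^ k) \<xi>) \<ge> (\<xi> - f \<xi>) / (E * H) * (y k - y (k + 3))"
    unfolding comm using distortion(2)[OF mem, of k] le by simp
qed

text \<open>If the displacement of a near-identity map is comparable with the length of a fundamental
  domain of \<^term>\<open>f\<close> at some point near \<^term>\<open>c\<close>, then conjugation by a power of \<^term>\<open>f\<close>
  makes it a small displacement without zeros on \<^term>\<open>D\<close>.\<close>

lemma zoom_in:
  obtains \<eta>0 A B where "\<eta>0 > 0" "A > 0" "B > 0"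
    "\<And>\<eta> \<epsilon> g k \<xi> u. 0 < \<eta> \<Longrightarrow> \<eta> \<le> \<eta>0 \<Longrightarrow> \<epsilon> \<le> B * \<eta> \<Longrightarrow> g \<in> G \<Longrightarrow> \<xi> \<in> D \<Longrightarrow>
      \<bar>g ((f ^^ k) \<xi>) - (f ^^ k) \<xi>\<bar> = \<eta> * ((f ^^ k) \<xi> - f ((f ^^ k) \<xi>)) \<Longrightarrow>
      (\<And>z. z \<in> (f ^^ k) ` D \<Longrightarrow> \<bar>(g z - z) - (g ((f ^^ k) \<xi>) - (f ^^ k) \<xi>)\<bar> \<le> \<epsilon> * \<bar>z - (f ^^ k) \<xi>\<bar>) \<Longrightarrow>
      u \<in> D \<Longrightarrow> inv (f ^^ k) (g ((f ^^ k) u)) \<noteq> u \<and> \<bar>inv (f ^^ k) (g ((f ^^ k) u)) - u\<bar> \<le> A * \<eta>"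
proof -
  have cont: "continuous_on D (\<lambda>x. x - f x)"
    by (intro continuous_intros G_continuous_on f)
  obtain m where m: "m \<in> D" "\<And>x. x \<in> D \<Longrightarrow> m - f m \<le> x - f x"
    using continuous_attains_inf[OF _ _ cont] y_order by auto
  define m1 where "m1 = (m - f m) / (E * H)"
  have EH: "E * H > 0" using E H by simp
  have "m \<in> {c<..d}" using m(1) D_subset by blast
  then have m1: "m1 > 0" unfolding m1_def using EH f_less[of m] by simp
  show thesis
  \<comment> \<open>The bound on \<open>\<eta>\<close> lets displacements up to
    \<open>2 * \<eta> * \<Lambda>\<close> pass through \<open>displaced_preimage\<close>. The factor
    \<open>m1 / 2\<close> keeps the variation of the displacement below half of its size at
    \<open>x\<close>, so that it cannot vanish.\<close>
  proof (rule that[of "margin / (E * H) / 2" "2 * (E * H)" "m1 / 2"])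
    show "margin / (E * H) / 2 > 0" "2 * (E * H) > 0" "m1 / 2 > 0"
      using m1 EH margin by auto
    fix \<eta> \<epsilon> g k \<xi> u
    assume \<eta>: "0 < \<eta>" "\<eta> \<le> margin / (E * H) / 2" and \<epsilon>: "\<epsilon> \<le> m1 / 2 * \<eta>" and g: "g \<in> G" and \<xi>: "\<xi> \<in> D"
      and eq: "\<bar>g ((f ^^ k) \<xi>) - (f ^^ k) \<xi>\<bar> = \<eta> * ((f ^^ k) \<xi> - f ((f ^^ k) \<xi>))"
      and lip: "\<And>z. z \<in> (f ^^ k) ` D \<Longrightarrow> \<bar>(g z - z) - (g ((f ^^ k) \<xi>) - (f ^^ k) \<xi>)\<bar> \<le> \<epsilon> * \<bar>z - (f ^^ k) \<xi>\<bar>"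
      and u: "u \<in> D"
    define x where "x = (f ^^ k) \<xi>"
    define z where "z = (f ^^ k) u"
    define \<Lambda> where "\<Lambda> = y k - y (k + 3)"
    have \<Lambda>: "\<Lambda> > 0"
      unfolding \<Lambda>_def using y_less[of k] y_antimono[of "Suc k" "k + 3"] by simp
    have len: "m1 * \<Lambda> \<le> x - f x" "x - f x \<le> \<Lambda>"
    proof -
      have "m1 * \<Lambda> \<le> (\<xi> - f \<xi>) / (E * H) * \<Lambda>"
        unfolding m1_def using m(2)[OF \<xi>] EH \<Lambda> by (intro mult_right_mono divide_right_mono) auto
      also have "\<dots> \<le> x - f x" unfolding x_def \<Lambda>_def by (rule fundamental_length(2)[OF \<xi>])
      finally show "m1 * \<Lambda> \<le> x - f x" .
      show "x - f x \<le> \<Lambda>" unfolding x_def \<Lambda>_def by (rule fundamental_length(1)[OF \<xi>])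
    qed
    have zx: "\<bar>z - x\<bar> \<le> \<Lambda>"
      using fk_D'[of u k] fk_D'[of \<xi> k] u \<xi> D_subset unfolding z_def x_def \<Lambda>_def by auto
    have "\<bar>(g z - z) - (g x - x)\<bar> \<le> \<epsilon> * \<bar>z - x\<bar>"
      using lip[of z] u by (simp add: z_def x_def)
    also have "\<dots> \<le> (m1 / 2 * \<eta>) * \<Lambda>"
      using \<epsilon> zx m1 \<eta> by (intro mult_mono) auto
    finally have diff: "\<bar>(g z - z) - (g x - x)\<bar> \<le> (m1 / 2 * \<eta>) * \<Lambda>" .
    have big: "\<bar>g x - x\<bar> \<ge> \<eta> * (m1 * \<Lambda>)" and small: "\<bar>g x - x\<bar> \<le> \<eta> * \<Lambda>"
      using eq len \<eta> unfolding x_def[symmetric] by (auto intro!: mult_left_mono)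
    have pos: "\<eta> * (m1 * \<Lambda>) > 0" using \<eta> m1 \<Lambda> by simp
    have half: "(m1 / 2 * \<eta>) * \<Lambda> = \<eta> * (m1 * \<Lambda>) / 2" by simp
    have nz: "g z \<noteq> z" using diff big pos half by linarith
    have le: "\<eta> * (m1 * \<Lambda>) \<le> \<eta> * \<Lambda>" using big small by linarith
    have "\<bar>g z - z\<bar> \<le> 2 * (\<eta> * \<Lambda>)" using diff small half le pos by linarith
    then have gz: "\<bar>g z - (f ^^ k) u\<bar> \<le> (2 * \<eta>) * (y k - y (k + 3))"
      by (simp add: z_def \<Lambda>_def)
    have "\<bar>inv (f ^^ k) (g z) - u\<bar> \<le> E * H * (2 * \<eta>)"
      by (rule displaced_preimage(2)[OF u gz]) (use \<eta> in simp)
    moreover have "inv (f ^^ k) (g z) \<noteq> u"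
      using nz G_inv_right[OF fk, of k "g z"] unfolding z_def by metis
    ultimately show "inv (f ^^ k) (g ((f ^^ k) u)) \<noteq> u \<and> \<bar>inv (f ^^ k) (g ((f ^^ k) u)) - u\<bar> \<le> 2 * (E * H) * \<eta>"
      by (simp add: z_def mult_ac)
  qed
qed

text \<open>A displacement that is everywhere small relative to the fundamental domains is not
  magnified much by any power of \<open>f\<close>. In the derivative of the conjugate, the factors
  from \<open>f ^^ k\<close> at \<open>u\<close> and at its displaced position \<open>v\<close>
  cancel up to a distortion proportional to the distance of \<open>u\<close> and
  \<open>v\<close>.\<close>

lemma conjugates_near_id:
  assumes e: "e > 0"
  obtains \<eta> \<epsilon> where "\<eta> > 0" "\<epsilon> > 0"
    "\<And>g k u. g \<in> G \<Longrightarrow> (\<And>x. \<bar>ln (deriv g x)\<bar> \<le> \<epsilon>) \<Longrightarrow>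
      (\<And>x. x \<in> {c<..y 1} \<Longrightarrow> \<bar>g x - x\<bar> < \<eta> * (x - f x)) \<Longrightarrow> u \<in> D \<Longrightarrow>
      \<bar>(inv (f ^^ k) \<circ> g \<circ> (f ^^ k)) u - u\<bar> \<le> e \<and> \<bar>ln (deriv (inv (f ^^ k) \<circ> g \<circ> (f ^^ k)) u)\<bar> \<le> e"
proof -
  \<comment> \<open>\<open>M * \<eta>\<close> bounds the change of
    \<open>ln (deriv (f ^^ k))\<close> between \<open>u\<close> and \<open>v\<close>; the later use
    of \<open>M + 1\<close> avoids a division by zero.\<close>
  define M where "M = L * E * E * (3 * (d - c))"
  have M: "M \<ge> 0" unfolding M_def using L(1) E cd by simp
  have EH: "E * H > 0" using E H by simp
  define \<eta> where "\<eta> = min (margin / (E * H)) (min (e / (E * H)) (e / (2 * (M + 1))))"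
  have \<eta>: "\<eta> > 0" "\<eta> \<le> margin / (E * H)" "\<eta> \<le> e / (E * H)" "\<eta> \<le> e / (2 * (M + 1))"
    unfolding \<eta>_def using EH margin e M by auto
  show thesis
  proof (rule that[of \<eta> "e / 2"])
    show "\<eta> > 0" "e / 2 > 0" using \<eta> e by auto
    fix g k u
    assume g: "g \<in> G" and lng: "\<And>x. \<bar>ln (deriv g x)\<bar> \<le> e / 2"
      and small: "\<And>x. x \<in> {c<..y 1} \<Longrightarrow> \<bar>g x - x\<bar> < \<eta> * (x - f x)" and u: "u \<in> D"
    define z where "z = (f ^^ k) u"
    define v where "v = inv (f ^^ k) (g z)"
    have u': "u \<in> D'" using u D_subset by blast
    have z: "z \<in> {c<..y 1}"
      using fk_D[OF u, of k] y_mem[of "k + 2"] y_antimono[of 1 "k + 1"] by (auto simp: z_def)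
    have "\<eta> * (z - f z) \<le> \<eta> * (y k - y (k + 3))"
      using fundamental_length(1)[OF u, of k] \<eta> by (intro mult_left_mono) (auto simp: z_def)
    with small[OF z] have gz: "\<bar>g z - (f ^^ k) u\<bar> \<le> \<eta> * (y k - y (k + 3))" by (simp add: z_def)
    have v: "v \<in> D'" and vu: "\<bar>v - u\<bar> \<le> E * H * \<eta>"
      unfolding v_def using displaced_preimage[OF u gz \<eta>(2)] by auto
    have "E * H * \<eta> \<le> e" using \<eta>(3) EH by (simp add: pos_le_divide_eq mult.commute)
    with vu have 1: "\<bar>v - u\<bar> \<le> e" by simp
    have "L * (\<Sum>i<k. \<bar>(f ^^ i) u - (f ^^ i) v\<bar>) \<le> L * (\<Sum>i<k. E * \<bar>u - v\<bar> / H * (y i - y (i + 3)))"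
      using distortion(1)[OF u' v] L(1) by (intro mult_left_mono sum_mono) auto
    also have "\<dots> = L * (E * \<bar>u - v\<bar> / H * (\<Sum>i<k. y i - y (i + 3)))"
      by (simp only: sum_distrib_left)
    also have "\<dots> \<le> L * (E * (E * H * \<eta>) / H * (3 * (d - c)))"
    proof (intro mult_left_mono[OF _ L(1)] mult_mono divide_right_mono)
      show "(\<Sum>i<k. y i - y (i + 3)) \<le> 3 * (d - c)" by (rule sum_lengths)
      show "(\<Sum>i<k. y i - y (i + 3)) \<ge> 0" using y_antimono by (intro sum_nonneg) auto
      show "\<bar>u - v\<bar> \<le> E * H * \<eta>" using vu by linarith
    qed (use E H \<eta> in auto)
    also have "\<dots> = M * \<eta>" unfolding M_def using H by simp
    also have "\<dots> \<le> e / 2"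
    proof -
      have "M * \<eta> \<le> (M + 1) * (e / (2 * (M + 1)))"
        using M \<eta> by (intro mult_mono) auto
      also have "\<dots> = e / 2" using M by (simp add: field_simps)
      finally show ?thesis .
    qed
    finally have "\<bar>ln (deriv (f ^^ k) u) - ln (deriv (f ^^ k) v)\<bar> \<le> e / 2"
      using ln_deriv_fk_diff[OF u' v, of k] by linarith
    moreover have "ln (deriv (inv (f ^^ k) \<circ> g \<circ> (f ^^ k)) u) =
        - ln (deriv (f ^^ k) v) + ln (deriv g z) + ln (deriv (f ^^ k) u)"
      using ln_deriv_comp[OF G_comp[OF G_inv[OF fk] g] fk, of k k u]
        ln_deriv_comp[OF G_inv[OF fk] g, of k z] ln_deriv_inv[OF fk, of k "g z"]
      by (simp add: z_def v_def)
    ultimately have "\<bar>ln (deriv (inv (f ^^ k) \<circ> g \<circ> (f ^^ k)) u)\<bar> \<le> e"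
      using lng[of z] by linarith
    with 1 show "\<bar>(inv (f ^^ k) \<circ> g \<circ> (f ^^ k)) u - u\<bar> \<le> e \<and> \<bar>ln (deriv (inv (f ^^ k) \<circ> g \<circ> (f ^^ k)) u)\<bar> \<le> e"
      by (simp add: v_def z_def)
  qed
qed

text \<open>Conjugation by one fixed map preserves C1-smallness, by uniform continuity of
  \<open>inv h\<close> and \<open>ln (deriv h)\<close> on compact sets.\<close>

lemma conjugate_by_h_near_id:
  assumes e: "e > 0"
  obtains e1 where "e1 > 0"
    "\<And>\<psi> x. \<psi> \<in> G \<Longrightarrow> (\<And>u. u \<in> D \<Longrightarrow> \<bar>\<psi> u - u\<bar> \<le> e1 \<and> \<bar>ln (deriv \<psi> u)\<bar> \<le> e1) \<Longrightarrow> h x \<in> D \<Longrightarrow>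
      \<bar>(inv h \<circ> \<psi> \<circ> h) x - x\<bar> \<le> e \<and> \<bar>ln (deriv (inv h \<circ> \<psi> \<circ> h) x)\<bar> \<le> e"
proof -
  define S where "S = inv h ` D'"
  have cS: "compact S" unfolding S_def
    by (intro compact_continuous_image G_continuous_on G_inv h) auto
  have "continuous_on S (\<lambda>x. ln (deriv h x))"
    using G_deriv_pos[OF h] by (intro continuous_intros G_deriv_continuous_on h) (auto simp: less_imp_neq[symmetric])
  then have "uniformly_continuous_on S (\<lambda>x. ln (deriv h x))"
    using cS by (rule compact_uniformly_continuous)
  then obtain r1 where r1: "r1 > 0" "\<And>x x'. x \<in> S \<Longrightarrow> x' \<in> S \<Longrightarrow> dist x' x < r1 \<Longrightarrow>
      dist (ln (deriv h x')) (ln (deriv h x)) < e / 2"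
    unfolding uniformly_continuous_on_def using e half_gt_zero by metis
  have "uniformly_continuous_on D' (inv h)"
    by (intro compact_uniformly_continuous G_continuous_on G_inv h) auto
  moreover have "min e r1 > 0" using e r1 by auto
  ultimately obtain r2 where r2: "r2 > 0" "\<And>x x'. x \<in> D' \<Longrightarrow> x' \<in> D' \<Longrightarrow> dist x' x < r2 \<Longrightarrow>
      dist (inv h x') (inv h x) < min e r1"
    unfolding uniformly_continuous_on_def by metis
  define e1 where "e1 = min (e / 2) (min (r2 / 2) margin)"
  show thesis
  proof (rule that[of e1])
    show "e1 > 0" using e r2 margin by (auto simp: e1_def)
    fix \<psi> x
    assume \<psi>: "\<psi> \<in> G" and small: "\<And>u. u \<in> D \<Longrightarrow> \<bar>\<psi> u - u\<bar> \<le> e1 \<and> \<bar>ln (deriv \<psi> u)\<bar> \<le> e1" and x: "h x \<in> D"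
    define w where "w = inv h (\<psi> (h x))"
    have s: "\<bar>\<psi> (h x) - h x\<bar> \<le> e1" "\<bar>ln (deriv \<psi> (h x))\<bar> \<le> e1" using small[OF x] by auto
    have m: "\<psi> (h x) \<in> D'" "h x \<in> D'"
      using D_margin[OF x, of "\<psi> (h x)"] s(1) x D_subset by (auto simp: e1_def)
    have "dist (\<psi> (h x)) (h x) < r2" using s(1) r2(1) by (auto simp: dist_real_def e1_def)
    from r2(2)[OF m(2,1) this] have wx: "dist w x < min e r1"
      by (simp add: w_def G_inv_left[OF h])
    have "x \<in> S" "w \<in> S" using m G_inv_left[OF h, of x] unfolding S_def w_def by force+
    with r1(2)[of x w] wx have "\<bar>ln (deriv h w) - ln (deriv h x)\<bar> < e / 2"
      by (auto simp: dist_real_def)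
    moreover have "ln (deriv (inv h \<circ> \<psi> \<circ> h) x) = - ln (deriv h w) + ln (deriv \<psi> (h x)) + ln (deriv h x)"
      using ln_deriv_comp[OF G_comp[OF G_inv[OF h] \<psi>] h, of x]
        ln_deriv_comp[OF G_inv[OF h] \<psi>, of "h x"] ln_deriv_inv[OF h, of "\<psi> (h x)"]
      by (simp add: w_def)
    moreover have "e1 \<le> e / 2" by (simp add: e1_def)
    ultimately have "\<bar>ln (deriv (inv h \<circ> \<psi> \<circ> h) x)\<bar> \<le> e" using s(2) by linarith
    with wx show "\<bar>(inv h \<circ> \<psi> \<circ> h) x - x\<bar> \<le> e \<and> \<bar>ln (deriv (inv h \<circ> \<psi> \<circ> h) x)\<bar> \<le> e"
      by (auto simp: dist_real_def w_def)
  qed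
qed

section \<open>Small displacements without zeros on \<open>D\<close>\<close>

lemma fundamental_domain:
  assumes x: "x \<in> {c<..y (Suc n)}"
  obtains k \<xi> where "k \<ge> n" "\<xi> \<in> D" "x = (f ^^ k) \<xi>"
proof -
  have "eventually (\<lambda>m. y m < x) sequentially"
    using order_tendstoD(2)[OF y_tendsto] x by auto
  then obtain m where m: "y m < x" using eventually_happens by force
  \<comment> \<open>The first \<open>y j\<close> below \<open>x\<close> locates \<open>x\<close>
    between \<open>y j\<close> and \<open>y (j - 1)\<close>; as \<open>D\<close> runs from
    \<open>y 2\<close> to \<open>y 1\<close>, this is its image at depth
    \<open>j - 2\<close>.\<close>
  define j where "j = (LEAST j. y j < x)"
  have j: "y j < x" unfolding j_def using m by (rule LeastI)
  have "j > Suc n" using j x y_antimono[of j "Suc n"] by (metis greaterThanAtMost_iff linorder_not_less order.strict_trans1 order_less_irrefl)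
  then obtain i where i: "j = Suc (Suc i)" "i \<ge> n" by (metis Suc_less_eq2 less_Suc_eq_le order_less_imp_le less_eq_Suc_le Suc_le_D Suc_le_mono)
  have "\<not> y (Suc i) < x" using not_less_Least[of "Suc i" "\<lambda>j. y j < x"] i(1) unfolding j_def by auto
  then have x': "x \<in> {y (i + 2)..y (i + 1)}" using j i by auto
  define \<xi> where "\<xi> = inv (f ^^ i) x"
  have xi: "x = (f ^^ i) \<xi>" unfolding \<xi>_def using G_inv_right[OF fk] by simp
  have "y 2 \<le> \<xi>" using x' G_le[OF fk, of i "y 2" \<xi>] by (simp add: fk_y xi[symmetric] add.commute)
  moreover have "\<xi> \<le> y 1" using x' G_le[OF fk, of i \<xi> "y 1"] by (simp add: fk_y xi[symmetric] add.commute)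
  ultimately show thesis using that[OF i(2) _ xi] by simp
qed


text \<open>Provides the exact proportion between displacement and fundamental domain that
  \<open>zoom_in\<close> demands.\<close>

lemma displacement_ivt:
  assumes g: "g \<in> G" and ab: "a \<le> b" and a: "\<bar>g a - a\<bar> \<ge> \<eta> * (a - f a)" and b: "\<bar>g b - b\<bar> \<le> \<eta> * (b - f b)"
  obtains x where "x \<in> {a..b}" "\<bar>g x - x\<bar> = \<eta> * (x - f x)"
proof -
  have "continuous_on {a..b} (\<lambda>x. \<bar>g x - x\<bar> - \<eta> * (x - f x))"
    by (intro continuous_intros G_continuous_on g f)
  from IVT2'[of "\<lambda>x. \<bar>g x - x\<bar> - \<eta> * (x - f x)" b 0 a, OF _ _ ab this] a b that show thesis by auto
qed

text \<open>If a C1-small \<open>g\<close> reaches the proportion \<open>\<eta>2\<close> of a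
  fundamental domain near \<open>c\<close>, zooming in there suffices. Otherwise its conjugates by
  powers of \<open>f\<close> are C1-small on \<open>D\<close>, one of them moves \<open>h c\<close>,
  and conjugating it by \<open>h\<close> gives a C1-small map near \<open>c\<close> that moves
  \<open>c\<close>. Fundamental domains shrink to nothing at \<open>c\<close>, so this map does
  reach the required proportion.\<close>

lemma small_moves:
  assumes nondisc: "\<And>\<epsilon>. \<epsilon> > 0 \<Longrightarrow> \<exists>g\<in>G. \<not> lifts_identity g \<and> (\<forall>x. \<bar>g x - x\<bar> \<le> \<epsilon> \<and> \<bar>ln (deriv g x)\<bar> \<le> \<epsilon>)"
    and e: "e > 0"
  shows "\<exists>\<phi>\<in>G. \<forall>u\<in>D. \<phi> u \<noteq> u \<and> \<bar>\<phi> u - u\<bar> \<le> e"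
proof -
  obtain \<eta>0 A B where zoom: "\<eta>0 > 0" "A > 0" "B > 0"
    "\<And>\<eta> \<epsilon> g k \<xi> u. 0 < \<eta> \<Longrightarrow> \<eta> \<le> \<eta>0 \<Longrightarrow> \<epsilon> \<le> B * \<eta> \<Longrightarrow> g \<in> G \<Longrightarrow> \<xi> \<in> D \<Longrightarrow>
      \<bar>g ((f ^^ k) \<xi>) - (f ^^ k) \<xi>\<bar> = \<eta> * ((f ^^ k) \<xi> - f ((f ^^ k) \<xi>)) \<Longrightarrow>
      (\<And>z. z \<in> (f ^^ k) ` D \<Longrightarrow> \<bar>(g z - z) - (g ((f ^^ k) \<xi>) - (f ^^ k) \<xi>)\<bar> \<le> \<epsilon> * \<bar>z - (f ^^ k) \<xi>\<bar>) \<Longrightarrow>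
      u \<in> D \<Longrightarrow> inv (f ^^ k) (g ((f ^^ k) u)) \<noteq> u \<and> \<bar>inv (f ^^ k) (g ((f ^^ k) u)) - u\<bar> \<le> A * \<eta>"
    by (rule zoom_in) blast
  \<comment> \<open>The index \<open>n\<close> records how near to \<open>c\<close> the derivative
    of \<open>g\<close> is controlled: everywhere for the original map, but only on
    \<open>{c..y j}\<close> for its conjugate by \<open>h\<close>.\<close>
  have zoomed: "\<exists>\<phi>\<in>G. \<forall>u\<in>D. \<phi> u \<noteq> u \<and> \<bar>\<phi> u - u\<bar> \<le> e"
    if \<eta>: "0 < \<eta>" "\<eta> \<le> \<eta>0" "A * \<eta> \<le> e" and g: "g \<in> G" and x: "x \<in> {c<..y (Suc n)}"
      and eq: "\<bar>g x - x\<bar> = \<eta> * (x - f x)"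
      and small: "\<And>x. x \<in> {c..y n} \<Longrightarrow> \<bar>ln (deriv g x)\<bar> \<le> \<epsilon>" and \<epsilon>: "\<epsilon> \<le> 1" "2 * \<epsilon> \<le> B * \<eta>"
    for \<eta> \<epsilon> g x n
  proof -
    obtain k \<xi> where k: "k \<ge> n" "\<xi> \<in> D" "x = (f ^^ k) \<xi>" using fundamental_domain[OF x] .
    have sub: "(f ^^ k) u \<in> {c..y n}" if "u \<in> D" for u
      using fk_D[OF that, of k] y_mem[of "k + 2"] y_antimono[of n "k + 1"] k(1) by auto
    have lip: "\<bar>(g z - z) - (g ((f ^^ k) \<xi>) - (f ^^ k) \<xi>)\<bar> \<le> 2 * \<epsilon> * \<bar>z - (f ^^ k) \<xi>\<bar>" if "z \<in> (f ^^ k) ` D" for z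
      using that sub k(2) by (intro displacement_lipschitz[OF g \<epsilon>(1) small]) auto
    have "\<forall>u\<in>D. (inv (f ^^ k) \<circ> g \<circ> (f ^^ k)) u \<noteq> u \<and> \<bar>(inv (f ^^ k) \<circ> g \<circ> (f ^^ k)) u - u\<bar> \<le> e"
    proof
      fix u assume u: "u \<in> D"
      show "(inv (f ^^ k) \<circ> g \<circ> (f ^^ k)) u \<noteq> u \<and> \<bar>(inv (f ^^ k) \<circ> g \<circ> (f ^^ k)) u - u\<bar> \<le> e"
        using zoom(4)[OF \<eta>(1,2) \<epsilon>(2) g k(2) _ lip u] eq \<eta>(3) unfolding k(3) by auto
    qed
    then show ?thesis using G_comp[OF G_comp[OF G_inv[OF fk] g] fk] by blast
  qed
  define \<eta> where "\<eta> = min \<eta>0 (e / A)"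
  have \<eta>: "\<eta> > 0" "\<eta> \<le> \<eta>0" "A * \<eta> \<le> e"
    using zoom(1,2) e by (auto simp: \<eta>_def min_def field_simps)
  have hD: "h c \<in> {y 2<..<y 1}" using hc by (simp add: y_def)
  have "(\<lambda>n. h (y n)) \<longlonglongrightarrow> h c" using G_isCont[OF h] y_tendsto by (rule isCont_tendsto_compose)
  then have "eventually (\<lambda>n. h (y n) < y 1) sequentially"
    using order_tendstoD(2) hD by auto
  then obtain j where j: "h (y j) < y 1" using eventually_happens by force
  have hsub: "h x \<in> D" if "x \<in> {c..y j}" for x
    using that G_le[OF h, of c x] G_le[OF h, of x "y j"] hD j by auto
  \<comment> \<open>The term with \<open>B\<close> serves the zoom; the last one keeps the
    displacement at \<open>y (Suc j)\<close> below the proportion \<open>\<eta>\<close>, as the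
    right end of the intermediate value argument.\<close>
  define e2 where "e2 = min (1/2) (min (B * \<eta> / 2) (\<eta> * (y (Suc j) - y (Suc (Suc j))) / 2))"
  have e2: "e2 > 0" "e2 \<le> 1" "2 * e2 \<le> B * \<eta>" "e2 \<le> \<eta> * (y (Suc j) - y (Suc (Suc j)))"
  proof -
    have "B * \<eta> > 0" "\<eta> * (y (Suc j) - y (Suc (Suc j))) > 0"
      using \<eta>(1) zoom(3) y_less[of "Suc j"] by simp_all
    then show "e2 > 0" "e2 \<le> 1" "2 * e2 \<le> B * \<eta>" "e2 \<le> \<eta> * (y (Suc j) - y (Suc (Suc j)))"
      unfolding e2_def by linarith+
  qed
  obtain e1 where e1: "e1 > 0"
    "\<And>\<psi> x. \<psi> \<in> G \<Longrightarrow> (\<And>u. u \<in> D \<Longrightarrow> \<bar>\<psi> u - u\<bar> \<le> e1 \<and> \<bar>ln (deriv \<psi> u)\<bar> \<le> e1) \<Longrightarrow> h x \<in> D \<Longrightarrow>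
      \<bar>(inv h \<circ> \<psi> \<circ> h) x - x\<bar> \<le> e2 \<and> \<bar>ln (deriv (inv h \<circ> \<psi> \<circ> h) x)\<bar> \<le> e2"
    by (rule conjugate_by_h_near_id[OF e2(1)]) blast
  obtain \<eta>1 \<epsilon>1 where conj: "\<eta>1 > 0" "\<epsilon>1 > 0"
    "\<And>g k u. g \<in> G \<Longrightarrow> (\<And>x. \<bar>ln (deriv g x)\<bar> \<le> \<epsilon>1) \<Longrightarrow>
      (\<And>x. x \<in> {c<..y 1} \<Longrightarrow> \<bar>g x - x\<bar> < \<eta>1 * (x - f x)) \<Longrightarrow> u \<in> D \<Longrightarrow>
      \<bar>(inv (f ^^ k) \<circ> g \<circ> (f ^^ k)) u - u\<bar> \<le> e1 \<and> \<bar>ln (deriv (inv (f ^^ k) \<circ> g \<circ> (f ^^ k)) u)\<bar> \<le> e1"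
    by (rule conjugates_near_id[OF e1(1)]) blast
  \<comment> \<open>If the proportion \<open>\<eta>2\<close> is reached it is small enough for
    zooming, and if not, \<open>conj\<close> applies.\<close>
  define \<eta>2 where "\<eta>2 = min \<eta> \<eta>1"
  have \<eta>2: "\<eta>2 > 0" "\<eta>2 \<le> \<eta>0" "A * \<eta>2 \<le> e" "\<eta>2 \<le> \<eta>1"
  proof -
    have "A * \<eta>2 \<le> A * \<eta>" unfolding \<eta>2_def using zoom(2) by (intro mult_left_mono) auto
    then show "A * \<eta>2 \<le> e" using \<eta>(3) by linarith
  qed (use \<eta> conj(1) in \<open>auto simp: \<eta>2_def\<close>)
  define \<epsilon> where "\<epsilon> = min (min 1 \<epsilon>1) (min (B * \<eta>2 / 2) (\<eta>2 * (y 1 - y 2)))"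
  have \<epsilon>: "\<epsilon> > 0" "\<epsilon> \<le> 1" "\<epsilon> \<le> \<epsilon>1" "2 * \<epsilon> \<le> B * \<eta>2" "\<epsilon> \<le> \<eta>2 * (y 1 - y 2)"
    using \<eta>2 conj(2) zoom(3) y_order by (auto simp: \<epsilon>_def)
  obtain g where g: "g \<in> G" "\<not> lifts_identity g" "\<And>x. \<bar>g x - x\<bar> \<le> \<epsilon>" "\<And>x. \<bar>ln (deriv g x)\<bar> \<le> \<epsilon>"
    using nondisc[OF \<epsilon>(1)] by blast
  show ?thesis
  proof (cases "\<exists>x\<in>{c<..y 1}. \<bar>g x - x\<bar> \<ge> \<eta>2 * (x - f x)")
    case True
    then obtain x where x: "x \<in> {c<..y 1}" "\<bar>g x - x\<bar> \<ge> \<eta>2 * (x - f x)" by blast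
    have "f (y 1) = y 2" using y_Suc[of 1] by (simp add: numeral_eq_Suc)
    then have "\<bar>g (y 1) - y 1\<bar> \<le> \<eta>2 * (y 1 - f (y 1))" using g(3)[of "y 1"] \<epsilon>(5) by simp
    then obtain x' where x': "x' \<in> {x..y 1}" "\<bar>g x' - x'\<bar> = \<eta>2 * (x' - f x')"
      using displacement_ivt[OF g(1) _ x(2)] x(1) by auto
    show ?thesis
      by (rule zoomed[OF \<eta>2(1-3) g(1) _ x'(2) g(4) \<epsilon>(2,4), of 0]) (use x x' in auto)
  next
    case False
    have lng: "\<bar>ln (deriv g x)\<bar> \<le> \<epsilon>1" for x using g(4)[of x] \<epsilon>(3) by linarith
    have small: "\<bar>g x - x\<bar> < \<eta>1 * (x - f x)" if "x \<in> {c<..y 1}" for x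
    proof -
      have "\<bar>g x - x\<bar> < \<eta>2 * (x - f x)" using False that by (meson not_le)
      also have "\<dots> \<le> \<eta>1 * (x - f x)"
        using \<eta>2(4) f_less[of x] that y_mem[of 1] by (intro mult_right_mono) auto
      finally show ?thesis .
    qed
    \<comment> \<open>These points tend to \<open>c\<close>; were they all fixed, the fixed points
      of \<open>g\<close> would accumulate.\<close>
    have "\<exists>k. g ((f ^^ k) (h c)) \<noteq> (f ^^ k) (h c)"
    proof (rule ccontr)
      assume no: "\<not> ?thesis"
      obtain w where w: "g w \<noteq> w"
        using g(2) unfolding lifts_identity_def by (metis add.right_neutral of_int_0)
      have hcd: "h c \<in> {c<..d}" using hD y_mem[of 1] y_mem[of 2] by auto
      have lim: "(\<lambda>k. (f ^^ k) (h c)) \<longlonglongrightarrow> c"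
        by (rule iterates_tendsto_fixpoint(1)[OF f fc f_less hcd])
      have "c islimpt {x. g x = x}"
        unfolding islimpt_sequential
      proof (intro exI conjI allI)
        show "(\<lambda>k. (f ^^ k) (h c)) \<longlonglongrightarrow> c" by (rule lim)
        show "(f ^^ k) (h c) \<in> {x. g x = x} - {c}" for k
          using no iterates_tendsto_fixpoint(2)[OF f fc f_less hcd, of k] by auto
      qed
      then show False using fixpoints_not_limpt[OF g(1) w] by blast
    qed
    then obtain k where k: "g ((f ^^ k) (h c)) \<noteq> (f ^^ k) (h c)" by blast
    define \<psi> where "\<psi> = inv (f ^^ k) \<circ> g \<circ> (f ^^ k)"
    have \<psi>: "\<psi> \<in> G" unfolding \<psi>_def by (intro G_comp G_inv fk g)
    define g2 where "g2 = inv h \<circ> \<psi> \<circ> h"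
    have g2: "g2 \<in> G" unfolding g2_def by (intro G_comp G_inv h \<psi>)
    have "\<psi> (h c) \<noteq> h c"
      using k G_inv_right[OF fk, of k "g ((f ^^ k) (h c))"] unfolding \<psi>_def by (metis comp_apply)
    then have g2c: "g2 c \<noteq> c"
      using G_inv_right[OF h, of "\<psi> (h c)"] unfolding g2_def by (metis comp_apply)
    have near: "\<bar>g2 x - x\<bar> \<le> e2 \<and> \<bar>ln (deriv g2 x)\<bar> \<le> e2" if "x \<in> {c..y j}" for x
      unfolding g2_def
      by (rule e1(2)[OF \<psi> _ hsub[OF that]]) (unfold \<psi>_def, rule conj(3)[OF g(1) lng small])
    have yj: "y (Suc j) \<in> {c..y j}" using y_mem[of "Suc j"] y_less[of j] by auto
    have "\<bar>g2 (y (Suc j)) - y (Suc j)\<bar> \<le> \<eta> * (y (Suc j) - f (y (Suc j)))"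
      using near[OF yj] e2(4) by (simp add: y_Suc)
    moreover have "\<bar>g2 c - c\<bar> \<ge> \<eta> * (c - f c)" by (simp add: fc)
    ultimately obtain x where x: "x \<in> {c..y (Suc j)}" "\<bar>g2 x - x\<bar> = \<eta> * (x - f x)"
      using displacement_ivt[OF g2, of c "y (Suc j)" \<eta>] yj by auto
    have "x \<noteq> c" using x(2) g2c by (auto simp: fc)
    then have x': "x \<in> {c<..y (Suc j)}" using x(1) by auto
    show ?thesis
      by (rule zoomed[OF \<eta> g2 x' x(2) _ e2(2,3)]) (use near in blast)
  qed
qed

end

section \<open>Minimality\<close>

context circle_group
begin

text \<open>Iterates that never passed \<open>t\<close> would increase to a fixed point in the
  interval.\<close>

lemma iterates_cross:
  assumes F: "F \<in> G" and up: "\<And>x. x \<in> {s..t} \<Longrightarrow> x < F x"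
  shows "\<exists>n. t < (F ^^ n) s"
proof (rule ccontr)
  assume no: "\<not> ?thesis"
  have mem: "(F ^^ n) s \<in> {s..t}" for n
  proof (induction n)
    case 0 then show ?case using no by (auto simp: not_less dest: spec[of _ 0])
  next
    case (Suc n)
    then have "s \<le> (F ^^ Suc n) s" using up[OF Suc] by auto
    moreover have "(F ^^ Suc n) s \<le> t" using no by (meson not_less)
    ultimately show ?case by auto
  qed
  have "incseq (\<lambda>n. (F ^^ n) s)"
    using up[OF mem] by (intro incseq_SucI) (simp add: less_imp_le)
  moreover have "\<forall>i. (F ^^ i) s \<le> t" using mem by auto
  ultimately obtain L where L: "(\<lambda>n. (F ^^ n) s) \<longlonglongrightarrow> L" "\<forall>i. (F ^^ i) s \<le> L"
    using incseq_convergent by blast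
  have "(\<lambda>n. F ((F ^^ n) s)) \<longlonglongrightarrow> F L" using G_isCont[OF F] L(1) by (rule isCont_tendsto_compose)
  moreover have "(\<lambda>n. F ((F ^^ n) s)) \<longlonglongrightarrow> L" using LIMSEQ_Suc[OF L(1)] by simp
  ultimately have "F L = L" using LIMSEQ_unique by blast
  moreover have "L \<le> t" by (rule LIMSEQ_le_const2[OF L(1)]) (use mem in auto)
  moreover have "s \<le> L" using L(2)[rule_format, of 0] by simp
  ultimately show False using up[of L] by auto
qed

text \<open>A displacement without zeros has constant sign on an interval; if it is negative, the
  inverse is taken.\<close>

lemma positive_small_moves:
  assumes sm: "\<And>e. e > 0 \<Longrightarrow> \<exists>\<phi>\<in>G. \<forall>u\<in>{a..b}. \<phi> u \<noteq> u \<and> \<bar>\<phi> u - u\<bar> \<le> e"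
    and ab: "a < \<alpha>" "\<alpha> < \<beta>" "\<beta> < b" and e: "e > 0"
  shows "\<exists>\<phi>\<in>G. \<forall>x\<in>{\<alpha>..\<beta>}. x < \<phi> x \<and> \<phi> x < x + e"
proof -
  \<comment> \<open>The second term keeps \<open>x + e'\<close> inside \<open>{a..b}\<close>, where
    the estimate for \<open>inv \<phi>\<close> evaluates \<open>\<phi>\<close>.\<close>
  define e' where "e' = min (e / 2) (b - \<beta>)"
  have e': "e' > 0" "e' < e" "e' \<le> b - \<beta>" using e ab by (auto simp: e'_def)
  obtain \<phi> where \<phi>: "\<phi> \<in> G" "\<And>u. u \<in> {a..b} \<Longrightarrow> \<phi> u \<noteq> u \<and> \<bar>\<phi> u - u\<bar> \<le> e'"
    using sm[OF e'(1)] by blast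
  have conn: "connected ((\<lambda>x. \<phi> x - x) ` {a..b})"
    by (intro connected_continuous_image continuous_intros G_continuous_on \<phi>(1)) auto
  have sign: "\<phi> x - x > 0" if "x \<in> {a..b}" "z \<in> {a..b}" "\<phi> z - z > 0" for x z
  proof (rule ccontr)
    assume "\<not> \<phi> x - x > 0"
    then have "0 \<in> (\<lambda>x. \<phi> x - x) ` {a..b}"
      using connectedD_interval[OF conn, of "\<phi> x - x" "\<phi> z - z" 0] that by auto
    then show False using \<phi>(2) by auto
  qed
  show ?thesis
  proof (cases "\<phi> \<alpha> > \<alpha>")
    case True
    have "x < \<phi> x \<and> \<phi> x < x + e" if "x \<in> {\<alpha>..\<beta>}" for x
      using sign[of x \<alpha>] \<phi>(2)[of x] that ab True e'(2) by auto
    then show ?thesis using \<phi>(1) by blast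
  next
    case False
    have neg: "\<phi> x < x" if "x \<in> {a..b}" for x
      using sign[of \<alpha> x] \<phi>(2)[OF that] that False ab by force
    have "x < inv \<phi> x \<and> inv \<phi> x < x + e" if x: "x \<in> {\<alpha>..\<beta>}" for x
    proof
      have "\<phi> x < \<phi> (inv \<phi> x)" using neg[of x] x ab by (simp add: G_inv_right[OF \<phi>(1)])
      then show "x < inv \<phi> x" using G_less[OF \<phi>(1)] by blast
      have "\<phi> (inv \<phi> x) \<le> \<phi> (x + e')"
        using abs_le_D2[OF conjunct2[OF \<phi>(2)[of "x + e'"]]] x ab e' by (simp add: G_inv_right[OF \<phi>(1)])
      then have "inv \<phi> x \<le> x + e'" using G_le[OF \<phi>(1)] by blast
      then show "inv \<phi> x < x + e" using e' by simp
    qed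
    then show ?thesis using G_inv[OF \<phi>(1)] by blast
  qed
qed

text \<open>The iterates of \<open>p\<close> under slow pushes come arbitrarily close to each point
  of \<open>{p..\<beta>}\<close>, so the closed set \<open>K\<close> contains this interval. Every
  orbit in \<open>K\<close> enters its interior, hence \<open>K\<close> is open as well as
  closed.\<close>

lemma minimal_set_UNIV:
  assumes K: "closed K" "\<And>F x. F \<in> G \<Longrightarrow> x \<in> K \<Longrightarrow> F x \<in> K"
    "\<And>z u v. z \<in> K \<Longrightarrow> K \<inter> {u<..<v} \<noteq> {} \<Longrightarrow> \<exists>F\<in>G. F z \<in> {u<..<v}"
    and p: "p \<in> K" "\<alpha> \<le> p" "p < \<beta>"
    and sm: "\<And>e. e > 0 \<Longrightarrow> \<exists>\<phi>\<in>G. \<forall>x\<in>{\<alpha>..\<beta>}. x < \<phi> x \<and> \<phi> x < x + e"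
  shows "K = UNIV"
proof -
  have sub: "{p..\<beta>} \<subseteq> K"
  proof
    fix z assume z: "z \<in> {p..\<beta>}"
    have "\<exists>k\<in>K. dist k z < e" if e: "e > 0" for e
    proof -
      obtain \<phi> where \<phi>: "\<phi> \<in> G" "\<And>x. x \<in> {\<alpha>..\<beta>} \<Longrightarrow> x < \<phi> x \<and> \<phi> x < x + e"
        using sm[OF e] by blast
      define n where "n = (LEAST n. z < (\<phi> ^^ n) p)"
      have "\<exists>n. z < (\<phi> ^^ n) p" by (rule iterates_cross[OF \<phi>(1)]) (use \<phi>(2) z p in auto)
      then have n: "z < (\<phi> ^^ n) p" unfolding n_def by (rule LeastI_ex)
      have "n \<noteq> 0" using n z by (intro notI) auto
      then obtain m where m: "n = Suc m" by (cases n) auto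
      have mz: "(\<phi> ^^ m) p \<le> z"
        using not_less_Least[of m "\<lambda>n. z < (\<phi> ^^ n) p"] m unfolding n_def by auto
      \<comment> \<open>The push is known only on \<open>{\<alpha>..\<beta>}\<close>. An iterate
        beyond \<open>z\<close> cannot come back, as \<open>z < \<phi> z\<close>; hence iterates up
        to \<open>z\<close> have always moved to the right.\<close>
      have ge: "(\<phi> ^^ i) p \<ge> p" if "(\<phi> ^^ i) p \<le> z" for i
        using that
      proof (induction i)
        case (Suc i)
        show ?case
        proof (cases "(\<phi> ^^ i) p \<le> z")
          case True
          then have "(\<phi> ^^ i) p \<in> {\<alpha>..\<beta>}" using Suc.IH z p by auto
          then show ?thesis using \<phi>(2) Suc.IH[OF True] by force
        next
          case False
          then have "\<phi> z < \<phi> ((\<phi> ^^ i) p)" using G_less[OF \<phi>(1)] by auto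
          moreover have "z < \<phi> z" using \<phi>(2)[of z] z p by auto
          ultimately show ?thesis using Suc.prems by auto
        qed
      qed simp
      have "(\<phi> ^^ n) p < (\<phi> ^^ m) p + e" using \<phi>(2)[of "(\<phi> ^^ m) p"] ge[OF mz] mz z p m by auto
      then have "dist ((\<phi> ^^ n) p) z < e" using n mz by (auto simp: dist_real_def)
      moreover have "(\<phi> ^^ n) p \<in> K" by (rule K(2)[OF G_funpow[OF \<phi>(1)] p(1)])
      ultimately show ?thesis by blast
    qed
    then have "z \<in> closure K" by (auto simp: closure_approachable)
    then show "z \<in> K" using K(1) by (simp add: closure_closed)
  qed
  have "open K"
    unfolding open_dist
  proof
    fix z assume z: "z \<in> K"
    have "(p + \<beta>) / 2 \<in> K \<inter> {p<..<\<beta>}" using sub p by (auto intro!: subsetD[OF sub])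
    then obtain F where F: "F \<in> G" "F z \<in> {p<..<\<beta>}" using K(3)[OF z, of p \<beta>] by blast
    have "open (F -` {p<..<\<beta>})" using G_isCont[OF F(1)] by (intro continuous_open_vimage) auto
    then obtain e where e: "e > 0" "\<And>x. dist x z < e \<Longrightarrow> F x \<in> {p<..<\<beta>}"
      using F(2) unfolding open_dist by (metis vimage_eq)
    have "x \<in> K" if "dist x z < e" for x
    proof -
      have "F x \<in> K" using e(2)[OF that] sub by auto
      then have "inv F (F x) \<in> K" by (rule K(2)[OF G_inv[OF F(1)]])
      then show ?thesis by (simp add: G_inv_left[OF F(1)])
    qed
    then show "\<exists>e>0. \<forall>x. dist x z < e \<longrightarrow> x \<in> K" using e(1) by blast
  qed
  then show ?thesis using K(1) p(1) clopen by blast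
qed

section \<open>Minimality, a contractible interval and slow pushes\<close>

lemma nondiscrete_ln:
  assumes "C1_nondiscrete G" "\<epsilon> > 0"
  shows "\<exists>g\<in>G. \<not> lifts_identity g \<and> (\<forall>x. \<bar>g x - x\<bar> \<le> \<epsilon> \<and> \<bar>ln (deriv g x)\<bar> \<le> \<epsilon>)"
proof -
  define r where "r = min (\<epsilon> / 2) (1 / 2)"
  have r: "r > 0" "r \<le> 1/2" "2 * r \<le> \<epsilon>" using assms(2) by (auto simp: r_def)
  obtain g :: "nat \<Rightarrow> real \<Rightarrow> real" where g: "\<And>n. g n \<in> G \<and> \<not> lifts_identity (g n)"
    "\<forall>\<epsilon>>0. \<forall>\<^sub>F n in sequentially. \<forall>x. \<bar>g n x - x\<bar> < \<epsilon> \<and> \<bar>deriv (g n) x - 1\<bar> < \<epsilon>"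
    using assms(1) unfolding C1_nondiscrete_def by blast
  obtain n where n: "\<forall>x. \<bar>g n x - x\<bar> < r \<and> \<bar>deriv (g n) x - 1\<bar> < r"
    using eventually_happens[OF g(2)[rule_format, OF r(1)]] by auto
  have "\<bar>g n x - x\<bar> \<le> \<epsilon> \<and> \<bar>ln (deriv (g n) x)\<bar> \<le> \<epsilon>" for x
    using n[rule_format, of x] abs_ln_le[of "deriv (g n) x"] r by auto
  then show ?thesis using g(1) by blast
qed

text \<open>The gap in the translation numbers gives a small nontrivial element a fixed point, and
  thereby a one-sided contraction at some \<open>c\<close> in the minimal set. The remaining work is
  to find \<open>h\<close> and an endpoint suitable for \<open>small_moves\<close>.\<close>

lemma minimal_with_small_moves:
  assumes fin: "finite (rot_image G)" and nofin: "\<not> has_finite_orbit G" and nd: "C1_nondiscrete G"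
  obtains c d \<alpha> \<beta> where "\<And>z u v. u < v \<Longrightarrow> \<exists>F\<in>G. F z \<in> {u<..<v}"
    "c < d" "\<And>e. e > 0 \<Longrightarrow> \<exists>F\<in>G. F d - F c < e"
    "\<alpha> < \<beta>" "\<And>e. e > 0 \<Longrightarrow> \<exists>\<phi>\<in>G. \<forall>x\<in>{\<alpha>..\<beta>}. x < \<phi> x \<and> \<phi> x < x + e"
proof -
  obtain \<kappa> where \<kappa>: "\<kappa> > 0" "\<And>F. F \<in> G \<Longrightarrow> \<bar>transl_num F\<bar> < \<kappa> \<Longrightarrow> transl_num F = 0"
    using finite_rot_imp_gap[OF fin] by blast
  obtain g where g: "g \<in> G" "\<not> lifts_identity g" "\<And>x. \<bar>g x - x\<bar> \<le> \<kappa> / 2"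
    using nondiscrete_ln[OF nd, of "\<kappa> / 2"] \<kappa>(1) by auto
  have "transl_num g \<le> \<kappa> / 2" "transl_num g \<ge> - (\<kappa> / 2)"
    using g(3) by (intro transl_num_le_displacement transl_num_ge_displacement g(1); smt (verit))+
  then have "transl_num g = 0" using \<kappa> g(1) by force
  then obtain w where w: "g w = w" using transl_num_zero_fixpoint[OF g(1)] by blast
  obtain K where K: "closed K" "K \<noteq> {}" "\<And>F x. F \<in> G \<Longrightarrow> x \<in> K \<Longrightarrow> F x \<in> K"
    "\<And>z u v. z \<in> K \<Longrightarrow> K \<inter> {u<..<v} \<noteq> {} \<Longrightarrow> \<exists>F\<in>G. F z \<in> {u<..<v}"
    using exists_minimal_set by blast
  obtain f c d where cf: "f \<in> G" "f c = c" "c < d" "\<And>x. x \<in> {c<..d} \<Longrightarrow> f x < x" "c \<in> K" "d \<in> K"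
    using contracting_fixpoint[of g w K, OF g(1) w g(2) nofin K(1,2)] K(3) by blast
  have less: "f u < f v \<longleftrightarrow> u < v" for u v by (rule G_less[OF cf(1)])
  have "f d \<in> K \<inter> {c<..<d}" using K(3)[OF cf(1) cf(6)] cf(4)[of d] cf(3) less[of c d] cf(2) by auto
  then obtain F where F: "F \<in> G" "F c \<in> {c<..<d}" using K(4)[OF cf(5), of c d] by blast
  define p0 where "p0 = F c"
  define h where "h = f \<circ> f \<circ> f \<circ> F"
  have h: "h \<in> G" unfolding h_def by (intro G_comp cf(1) F(1))
  have ord: "c < f p0" "f p0 < p0" "f (f p0) < f p0" "f (f (f p0)) < f (f p0)" "c < f (f (f p0))" "p0 < d"
    using F(2) cf(4)[of p0] less[of c p0] less[of "f p0" p0] less[of "f (f p0)" "f p0"] less[of c "f p0"]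
      less[of c "f (f p0)"] cf(2) by (auto simp: p0_def)
  \<comment> \<open>With \<open>y1\<close> between \<open>h c\<close> and \<open>f (f p0)\<close>,
    the endpoint \<open>d'\<close> satisfying \<open>f d' = y1\<close> yields
    \<open>f y1 < h c < y1\<close>, so \<open>h c\<close> is interior to the fundamental
    domain.\<close>
  define y1 where "y1 = (f (f (f p0)) + f (f p0)) / 2"
  have y1: "f (f (f p0)) < y1" "y1 < f (f p0)" using ord by (auto simp: y1_def)
  define d' where "d' = inv f y1"
  have fd': "f d' = y1" unfolding d'_def by (rule G_inv_right[OF cf(1)])
  have d': "c < d'" "d' < f p0"
    using less[of c d'] less[of d' "f p0"] y1 ord cf(2) fd' by auto
  interpret contraction G f h c d'
  proof
    show "f x < x" if "x \<in> {c<..d'}" for x using that cf(4) d' ord by auto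
    have "f y1 < f (f (f p0))" using y1 less by blast
    then show "(f ^^ 2) d' < h c" by (simp add: numeral_2_eq_2 fd' h_def p0_def)
    show "h c < (f ^^ 1) d'" using y1 by (simp add: fd' h_def p0_def)
  qed (use cf h d' in auto)
  have hc': "y 2 < h c" "h c < y 1" using hc by (simp_all add: y_def)
  define \<alpha> where "\<alpha> = (y 2 + h c) / 2"
  define \<beta> where "\<beta> = (h c + y 1) / 2"
  have ab: "y 2 < \<alpha>" "\<alpha> < h c" "h c < \<beta>" "\<beta> < y 1" using hc' by (auto simp: \<alpha>_def \<beta>_def)
  have sm: "\<exists>\<phi>\<in>G. \<forall>x\<in>{\<alpha>..\<beta>}. x < \<phi> x \<and> \<phi> x < x + e" if "e > 0" for e
    by (rule positive_small_moves[of "y 2" "y 1"]) (use small_moves nondiscrete_ln[OF nd] ab that in auto)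
  have "K = UNIV"
    by (rule minimal_set_UNIV[of K "h c" \<alpha> \<beta>]) (use K h cf(5) ab sm in auto)
  then have min: "\<exists>F\<in>G. F z \<in> {u<..<v}" if "u < v" for z u v :: real
    using K(4)[of z u v] that by auto
  have con: "\<exists>F\<in>G. F d - F c < e" if e: "e > 0" for e
  proof -
    have "(\<lambda>k. (f ^^ k) d) \<longlonglongrightarrow> c"
      by (rule iterates_tendsto_fixpoint[OF cf(1,2,4)]) (use cf(3) in auto)
    then have "eventually (\<lambda>k. (f ^^ k) d < c + e) sequentially"
      using e by (intro order_tendstoD) auto
    then obtain k where "(f ^^ k) d < c + e" using eventually_happens by force
    moreover have "(f ^^ k) c = c" using cf(2) by (induction k) auto
    ultimately show ?thesis by (intro bexI[of _ "f ^^ k"] fk) auto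
  qed
  show thesis
    by (rule that[of c d \<alpha> \<beta>]) (use min con sm ab cf(3) in auto)
qed

end

section \<open>Proximality and the final contradiction\<close>

locale proximal = circle_group +
  fixes c d \<alpha> \<beta> :: real
  assumes minimal: "\<And>z u v. u < v \<Longrightarrow> \<exists>F\<in>G. F z \<in> {u<..<v}"
    and cd: "c < d" and contracts: "\<And>e. e > 0 \<Longrightarrow> \<exists>F\<in>G. F d - F c < e"
    and \<alpha>\<beta>: "\<alpha> < \<beta>"
    and small_moves: "\<And>e. e > 0 \<Longrightarrow> \<exists>\<phi>\<in>G. \<forall>x\<in>{\<alpha>..\<beta>}. x < \<phi> x \<and> \<phi> x < x + e"
begin

text \<open>The order of \<open>x\<close> and \<open>y\<close> is left free: for
  \<open>y \<le> x\<close> the condition holds trivially, so the admissible \<open>y\<close> form a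
  half-line.\<close>

definition contr where "contr x y \<longleftrightarrow> (\<forall>e>0. \<exists>F\<in>G. F y - F x < e)"

text \<open>For a finite cover of a group of Moebius transformations, this is a generator of the group of
  deck transformations.\<close>

definition \<Theta> where "\<Theta> x = Sup {y. contr x y}"

text \<open>By minimality the preimages of the interval cover a period; \<open>e\<close> is a
  Lebesgue number of this cover, and integer translations extend it to the line.\<close>

lemma uniformly_into:
  assumes "u < v"
  obtains e where "e > 0" "\<And>z. \<exists>F\<in>G. \<forall>w. \<bar>w - z\<bar> < e \<longrightarrow> F w \<in> {u<..<v}"
proof -
  define C where "C = (\<lambda>F. F -` {u<..<v}) ` G"
  have op: "open S" if S: "S \<in> C" for S
  proof -
    obtain F where "F \<in> G" "S = F -` {u<..<v}" using S unfolding C_def by blast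
    then show ?thesis using G_isCont by (simp add: continuous_open_vimage)
  qed
  have cov: "{0..1} \<subseteq> \<Union>C" using minimal[OF assms] by (auto simp: C_def)
  have "\<exists>e>0. \<forall>x\<in>{0..1}. \<exists>S\<in>C. ball x e \<subseteq> S"
  proof (rule Heine_Borel_lemma[OF compact_Icc cov op])
    fix e :: real assume "e > 0" "\<And>x. x \<in> {0..1} \<Longrightarrow> \<exists>S\<in>C. ball x e \<subseteq> S"
    then show ?thesis by (intro exI[of _ e] conjI ballI)
  qed
  then obtain e where e: "e > 0" "\<And>x. x \<in> {0..1} \<Longrightarrow> \<exists>S\<in>C. ball x e \<subseteq> S"
    by meson
  have "\<exists>F\<in>G. \<forall>w. \<bar>w - z\<bar> < e \<longrightarrow> F w \<in> {u<..<v}" for z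
  proof -
    have "frac z \<in> {0..1}" using frac_lt_1[of z] by auto
    from e(2)[OF this] obtain S where S: "S \<in> C" "ball (frac z) e \<subseteq> S" by blast
    then obtain F where F: "F \<in> G" "ball (frac z) e \<subseteq> F -` {u<..<v}" unfolding C_def by blast
    have "F \<circ> (\<lambda>x. x + of_int (- \<lfloor>z\<rfloor>)) \<in> G" by (intro G_comp F(1) G_translation)
    moreover have "(F \<circ> (\<lambda>x. x + of_int (- \<lfloor>z\<rfloor>))) w \<in> {u<..<v}" if "\<bar>w - z\<bar> < e" for w
    proof -
      have "w - of_int \<lfloor>z\<rfloor> \<in> ball (frac z) e"
        using that by (simp add: dist_real_def frac_def abs_minus_commute)
      then have "F (w - of_int \<lfloor>z\<rfloor>) \<in> {u<..<v}" using F(2) by blast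
      then show ?thesis by simp
    qed
    ultimately show ?thesis by blast
  qed
  with e(1) that show thesis by blast
qed

lemma contr_subinterval:
  assumes "contr x y" "x \<le> x'" "y' \<le> y"
  shows "contr x' y'"
  unfolding contr_def
proof (intro allI impI)
  fix e :: real assume "e > 0"
  then obtain F where F: "F \<in> G" "F y - F x < e" using assms(1) unfolding contr_def by blast
  moreover have "F x \<le> F x'" "F y' \<le> F y" using assms G_le[OF F(1)] by auto
  ultimately show "\<exists>F\<in>G. F y' - F x' < e" by (intro bexI[of _ F]) auto
qed

lemma contr_G:
  assumes F: "F \<in> G" shows "contr (F x) (F y) \<longleftrightarrow> contr x y"
proof
  assume l: "contr (F x) (F y)"
  show "contr x y" unfolding contr_def
  proof (intro allI impI)
    fix e :: real assume "e > 0"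
    then obtain H where "H \<in> G" "H (F y) - H (F x) < e" using l unfolding contr_def by blast
    then show "\<exists>F\<in>G. F y - F x < e" using G_comp[OF _ F] by (intro bexI[of _ "H \<circ> F"]) auto
  qed
next
  assume r: "contr x y"
  show "contr (F x) (F y)" unfolding contr_def
  proof (intro allI impI)
    fix e :: real assume "e > 0"
    then obtain H where "H \<in> G" "H y - H x < e" using r unfolding contr_def by blast
    then show "\<exists>H\<in>G. H (F y) - H (F x) < e"
      using G_comp[OF _ G_inv[OF F]] by (intro bexI[of _ "H \<circ> inv F"]) (auto simp: G_inv_left[OF F])
  qed
qed

text \<open>Uniformly short intervals can be moved into \<open>{c<..<d}\<close>, which is
  contractible.\<close>

lemma contr_local:
  obtains \<delta> where "\<delta> > 0" "\<And>x. contr x (x + \<delta>)"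
proof -
  obtain e where e: "e > 0" "\<And>z. \<exists>F\<in>G. \<forall>w. \<bar>w - z\<bar> < e \<longrightarrow> F w \<in> {c<..<d}"
    using uniformly_into[OF cd] by blast
  have "contr x (x + e / 2)" for x
  proof -
    obtain F where F: "F \<in> G" "\<forall>w. \<bar>w - x\<bar> < e \<longrightarrow> F w \<in> {c<..<d}" using e(2) by blast
    have "F x \<in> {c<..<d}" "F (x + e / 2) \<in> {c<..<d}" using F(2) e(1) by auto
    then have le: "c \<le> F x" "F (x + e / 2) \<le> d" by auto
    have "contr c d" unfolding contr_def using contracts by (intro allI impI)
    from contr_subinterval[OF this le] show ?thesis by (simp only: contr_G[OF F(1)])
  qed
  with that[of "e / 2"] e(1) show thesis by auto
qed

lemma not_contr_period: "\<not> contr x (x + 1)"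
proof
  assume "contr x (x + 1)"
  then obtain F where "F \<in> G" "F (x + 1) - F x < 1"
    unfolding contr_def using zero_less_one by blast
  then show False using G_plus1[of F x] by simp
qed

lemma contr_less: "contr x y \<Longrightarrow> y < x + 1"
  using contr_subinterval[of x y x "x + 1"] not_contr_period[of x] by force

text \<open>The supremum is not attained: once \<open>F\<close> has shrunk the interval below the
  uniform length \<open>\<delta>\<close>, there is room for a longer contractible one starting at
  \<open>F x\<close>, and its preimage ends beyond \<open>y\<close>.\<close>

lemma contr_iff: "contr x y \<longleftrightarrow> y < \<Theta> x"
proof
  have bdd: "bdd_above {y. contr x y}" 
    by (rule bdd_aboveI[of _ "x + 1"]) (simp add: contr_less less_imp_le)
  obtain \<delta> where \<delta>: "\<delta> > 0" "\<And>x. contr x (x + \<delta>)" using contr_local by blast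
  {
    assume "contr x y"
    then obtain F where F: "F \<in> G" "F y - F x < \<delta>" using \<delta>(1) unfolding contr_def by blast
    define y' where "y' = inv F (F x + \<delta>)"
    have Fy': "F y' = F x + \<delta>" unfolding y'_def by (rule G_inv_right[OF F(1)])
    then have "contr x y'" using contr_G[OF F(1), of x y'] \<delta>(2) by simp
    then have "y' \<le> \<Theta> x" unfolding \<Theta>_def using bdd by (intro cSup_upper) auto
    moreover have "y < y'" using F(2) Fy' G_less[OF F(1), of y y'] by simp
    ultimately show "y < \<Theta> x" by simp
  }
  assume y: "y < \<Theta> x"
  have "{y. contr x y} \<noteq> {}" using \<delta>(2)[of x] by blast
  then obtain y' where "contr x y'" "y < y'"
    using less_cSup_iff[OF _ bdd, of y] y unfolding \<Theta>_def by auto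
  then show "contr x y" using contr_subinterval[of x y' x y] by simp
qed

lemma \<Theta>_G:
  assumes F: "F \<in> G" shows "\<Theta> (F x) = F (\<Theta> x)"
proof -
  have *: "z < \<Theta> (F x) \<longleftrightarrow> z < F (\<Theta> x)" for z
  proof -
    have "z = F (inv F z)" by (simp add: G_inv_right[OF F])
    then show ?thesis
      using contr_G[OF F, of x "inv F z"] contr_iff[of "F x" z] contr_iff[of x "inv F z"]
        G_less[OF F, of "inv F z" "\<Theta> x"] by simp
  qed
  show ?thesis using *[of "\<Theta> (F x)"] *[of "F (\<Theta> x)"] by simp
qed

lemma \<Theta>_le: "\<Theta> x \<le> x + 1"
  using contr_iff[of x "x + 1"] not_contr_period[of x] by simp

lemma \<Theta>_ge: obtains \<delta> where "\<delta> > 0" "\<And>x. x + \<delta> \<le> \<Theta> x"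
proof -
  obtain \<delta> where \<delta>: "\<delta> > 0" "\<And>x. contr x (x + \<delta>)" using contr_local by blast
  have "x + \<delta> \<le> \<Theta> x" for x using \<delta>(2)[of x] by (simp add: contr_iff)
  with \<delta>(1) that show thesis by blast
qed

lemma \<Theta>_mono: "x \<le> y \<Longrightarrow> \<Theta> x \<le> \<Theta> y"
proof (rule ccontr)
  assume xy: "x \<le> y" and "\<not> \<Theta> x \<le> \<Theta> y"
  then have "contr x (\<Theta> y)" by (simp add: contr_iff)
  then have "contr y (\<Theta> y)" using xy by (rule contr_subinterval) simp
  then show False by (simp add: contr_iff)
qed

text \<open>If \<open>\<Theta>\<close> were constant on some interval, minimality and
  \<open>\<Theta>_G\<close> would make it locally constant everywhere, hence constant, although it
  commutes with the unit translation.\<close>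

lemma \<Theta>_strict_mono: "x < y \<Longrightarrow> \<Theta> x < \<Theta> y"
proof (rule ccontr)
  assume xy: "x < y" and "\<not> \<Theta> x < \<Theta> y"
  then have eq: "\<Theta> x = \<Theta> y" using \<Theta>_mono[of x y] by auto
  have flat: "\<Theta> z = \<Theta> x" if "z \<in> {x..y}" for z
    using \<Theta>_mono[of x z] \<Theta>_mono[of z y] that eq by auto
  have "eventually (\<lambda>b. \<Theta> a = \<Theta> b) (at a within UNIV)" for a
  proof -
    obtain F where F: "F \<in> G" "F a \<in> {x<..<y}" using minimal[OF xy] by blast
    have "eventually (\<lambda>b. F b \<in> {x<..<y}) (at a)"
      using G_isCont[OF F(1), of a] F(2) unfolding isCont_def
      by (intro topological_tendstoD) auto
    then show ?thesis
    proof eventually_elim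
      case (elim b)
      then have "\<Theta> (F b) = \<Theta> (F a)" using flat[of "F a"] flat[of "F b"] F(2) by auto
      then show ?case using \<Theta>_G[OF F(1)] G_eq[OF F(1)] by simp
    qed
  qed
  then have "\<Theta> 0 = \<Theta> 1" by (intro connected_local_const[of UNIV]) auto
  moreover have "\<Theta> 1 = \<Theta> 0 + 1" using \<Theta>_G[OF G_shift, of 0] by simp
  ultimately show False by simp
qed

lemma \<Theta>_less_iff: "\<Theta> x < \<Theta> y \<longleftrightarrow> x < y"
  using \<Theta>_strict_mono[of x y] \<Theta>_mono[of y x] by force

text \<open>The range contains an orbit and is therefore dense, and a monotone map with dense range
  has no jumps.\<close>

lemma \<Theta>_surj: "\<exists>x. \<Theta> x = y"
proof -
  obtain \<delta> where \<delta>: "\<delta> > 0" "\<And>x. x + \<delta> \<le> \<Theta> x" using \<Theta>_ge by blast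
  define A where "A = {x. \<Theta> x \<le> y}"
  define x where "x = Sup A"
  have ne: "y - 1 \<in> A" using \<Theta>_le[of "y - 1"] by (simp add: A_def)
  have bdd: "bdd_above A" unfolding bdd_above_def
  proof (intro exI ballI)
    fix z assume "z \<in> A" then show "z \<le> y" using \<delta>(1) \<delta>(2)[of z] by (simp add: A_def)
  qed
  have dense: "\<exists>z. u < \<Theta> z \<and> \<Theta> z < v" if uv: "u < v" for u v
  proof -
    obtain F where "F \<in> G" "F (\<Theta> 0) \<in> {u<..<v}" using minimal[OF uv] by blast
    then show ?thesis using \<Theta>_G[of F 0] by (intro exI[of _ "F 0"]) auto
  qed
  have "\<not> \<Theta> x < y"
  proof
    assume "\<Theta> x < y"
    then obtain z where z: "\<Theta> x < \<Theta> z" "\<Theta> z < y" using dense by blast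
    then have "z \<le> x" unfolding x_def by (intro cSup_upper bdd) (simp add: A_def)
    then show False using z \<Theta>_mono[of z x] by simp
  qed
  moreover have "\<not> y < \<Theta> x"
  proof
    assume "y < \<Theta> x"
    then obtain z where z: "y < \<Theta> z" "\<Theta> z < \<Theta> x" using dense by blast
    then have "z < x" by (simp add: \<Theta>_less_iff)
    then obtain z' where "z' \<in> A" "z < z'"
      using less_cSup_iff[of A z] ne bdd unfolding x_def by auto
    then show False using z \<Theta>_mono[of z z'] by (simp add: A_def)
  qed
  ultimately show ?thesis by (intro exI[of _ x]) auto
qed

lemma \<Theta>_continuous_on: "continuous_on S \<Theta>"
proof -
  have "range \<Theta> = UNIV" using \<Theta>_surj by (metis surj_def)
  then have "continuous_on UNIV \<Theta>" using \<Theta>_mono by (intro continuous_onI_mono) auto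
  then show ?thesis using continuous_on_subset by blast
qed

section \<open>Slow pushes with a prescribed exceptional arc\<close>

lemma contract_into:
  assumes "contr x y" "u < v" "x \<le> y"
  obtains F where "F \<in> G" "u < F x" "F y < v"
proof -
  obtain e where e: "e > 0" "\<And>z. \<exists>F\<in>G. \<forall>w. \<bar>w - z\<bar> < e \<longrightarrow> F w \<in> {u<..<v}"
    using uniformly_into[OF assms(2)] by blast
  obtain H where H: "H \<in> G" "H y - H x < e" using assms(1) e(1) unfolding contr_def by blast
  obtain F where F: "F \<in> G" "\<forall>w. \<bar>w - H x\<bar> < e \<longrightarrow> F w \<in> {u<..<v}" using e(2) by blast
  have "H x \<le> H y" using G_le[OF H(1)] assms(3) by blast
  then have "F (H x) \<in> {u<..<v}" "F (H y) \<in> {u<..<v}" using F(2) H(2) e(1) by auto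
  then show thesis using that[OF G_comp[OF F(1) H(1)]] by auto
qed

text \<open>Modulo \<open>\<Theta>\<close>, the complement of the pushed interval is contractible
  because \<open>\<Theta> \<alpha> < \<Theta> \<beta>'\<close>. An element \<open>h\<close> shrinks
  it into a neighbourhood of \<open>q\<close>, and conjugation by \<open>h\<close> carries the
  pushes along. The endpoints do not depend on \<open>e2\<close>, so the speed can be chosen after
  them.\<close>

lemma slow_push:
  assumes e: "e > 0"
  obtains s s' where "s < s'" "q - e < s'" "s' < \<Theta> s" "\<Theta> s < q + e"
    "\<And>e2. e2 > 0 \<Longrightarrow> \<exists>a\<in>G. \<forall>x\<in>{s..s'}. x < a x \<and> a x < x + e2"
proof -
  obtain \<delta> where \<delta>: "\<delta> > 0" "\<And>x. contr x (x + \<delta>)" using contr_local by blast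
  \<comment> \<open>Shortening the pushed interval ensures
    \<open>\<beta>' < \<Theta> \<alpha>\<close>, so that it is less than a period of
    \<open>\<Theta>\<close>.\<close>
  define \<beta>' where "\<beta>' = min \<beta> (\<alpha> + \<delta>)"
  have \<beta>': "\<alpha> < \<beta>'" "\<beta>' \<le> \<beta>" "\<beta>' \<le> \<alpha> + \<delta>" using \<alpha>\<beta> \<delta> by (auto simp: \<beta>'_def)
  have lt: "\<beta>' < \<Theta> \<alpha>" using contr_iff[of \<alpha> "\<alpha> + \<delta>"] \<delta>(2) \<beta>'(3) by simp
  have "contr \<beta>' (\<Theta> \<alpha>)" using contr_iff \<Theta>_strict_mono[OF \<beta>'(1)] by blast
  then obtain h where h: "h \<in> G" "q - e < h \<beta>'" "h (\<Theta> \<alpha>) < q + e"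
    using contract_into[of \<beta>' "\<Theta> \<alpha>" "q - e" "q + e"] lt e by auto
  show thesis
  proof (rule that[of "h \<alpha>" "h \<beta>'"])
    show "h \<alpha> < h \<beta>'" "q - e < h \<beta>'" "h \<beta>' < \<Theta> (h \<alpha>)" "\<Theta> (h \<alpha>) < q + e"
      using h \<beta>' lt G_less[OF h(1)] by (auto simp: \<Theta>_G)
    fix e2 :: real assume e2: "e2 > 0"
    \<comment> \<open>The extra unit makes room for the pushed points
      \<open>\<phi> u\<close>.\<close>
    have "uniformly_continuous_on {\<alpha>..\<beta> + 1} h"
      by (intro compact_uniformly_continuous G_continuous_on h) auto
    then obtain r where r: "r > 0" "\<And>x x'. x \<in> {\<alpha>..\<beta> + 1} \<Longrightarrow> x' \<in> {\<alpha>..\<beta> + 1} \<Longrightarrow> dist x' x < r \<Longrightarrow> dist (h x') (h x) < e2"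
      using e2 unfolding uniformly_continuous_on_def by metis
    obtain \<phi> where \<phi>: "\<phi> \<in> G" "\<forall>x\<in>{\<alpha>..\<beta>}. x < \<phi> x \<and> \<phi> x < x + min r 1"
      using small_moves[of "min r 1"] r(1) by auto
    have "x < (h \<circ> \<phi> \<circ> inv h) x \<and> (h \<circ> \<phi> \<circ> inv h) x < x + e2" if x: "x \<in> {h \<alpha>..h \<beta>'}" for x
    proof -
      define u where "u = inv h x"
      have xu: "x = h u" unfolding u_def by (simp add: G_inv_right[OF h(1)])
      have u: "u \<in> {\<alpha>..\<beta>}" using x \<beta>' unfolding xu by (auto simp: G_le[OF h(1)])
      then have \<phi>u: "u < \<phi> u" "\<phi> u < u + r" "\<phi> u < u + 1" using \<phi>(2) by force+
      then have "dist (h (\<phi> u)) (h u) < e2" using u by (intro r(2)) (auto simp: dist_real_def)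
      moreover have "h u < h (\<phi> u)" using \<phi>u G_less[OF h(1)] by blast
      ultimately show ?thesis by (simp add: u_def[symmetric] xu[symmetric] dist_real_def)
    qed
    then show "\<exists>a\<in>G. \<forall>x\<in>{h \<alpha>..h \<beta>'}. x < a x \<and> a x < x + e2"
      using G_comp[OF G_comp[OF h(1) \<phi>(1)] G_inv[OF h(1)]] by blast
  qed
qed

text \<open>The alternatives are the two stretches between the exceptional arc at \<open>q\<close>
  and its neighbours modulo \<open>\<Theta>\<close>. The estimate passes from the first to the
  second because \<open>b\<close> commutes with \<open>\<Theta>\<close>; uniform continuity of
  \<open>\<Theta>\<close> controls the change of speed.\<close>

lemma slow_push_periodic:
  assumes e: "e > 0"
  shows "\<exists>b\<in>G. \<forall>x. x \<le> q - e \<and> q + e \<le> \<Theta> x \<or> q + e \<le> x \<and> x \<le> \<Theta> (q - e) \<longrightarrow> x < b x \<and> b x < x + e"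
proof -
  obtain s s' where s: "s < s'" "q - e < s'" "s' < \<Theta> s" "\<Theta> s < q + e"
    "\<And>e2. e2 > 0 \<Longrightarrow> \<exists>a\<in>G. \<forall>x\<in>{s..s'}. x < a x \<and> a x < x + e2"
    using slow_push[OF e, of q] by blast
  have "uniformly_continuous_on {s..s' + 1} \<Theta>"
    by (intro compact_uniformly_continuous \<Theta>_continuous_on) auto
  then obtain r where r: "r > 0" "\<And>x x'. x \<in> {s..s' + 1} \<Longrightarrow> x' \<in> {s..s' + 1} \<Longrightarrow> dist x' x < r \<Longrightarrow> dist (\<Theta> x') (\<Theta> x) < e"
    using e unfolding uniformly_continuous_on_def by metis
  obtain b where b: "b \<in> G" "\<forall>x\<in>{s..s'}. x < b x \<and> b x < x + min e (min r 1)"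
    using s(5)[of "min e (min r 1)"] r(1) e by auto
  have "x < b x \<and> b x < x + e" if "x \<le> q - e \<and> q + e \<le> \<Theta> x \<or> q + e \<le> x \<and> x \<le> \<Theta> (q - e)" for x
    using that
  proof
    assume "x \<le> q - e \<and> q + e \<le> \<Theta> x"
    then have "\<Theta> s < \<Theta> x" "x \<le> s'" using s by auto
    then have "x \<in> {s..s'}" by (simp add: \<Theta>_less_iff)
    then show ?thesis using b(2) by force
  next
    assume x: "q + e \<le> x \<and> x \<le> \<Theta> (q - e)"
    obtain z where z: "x = \<Theta> z" using \<Theta>_surj by metis
    have "\<Theta> s < \<Theta> z" "\<Theta> z \<le> \<Theta> (q - e)" using x s z by auto
    then have zs: "s < z" "z \<le> s'" using s \<Theta>_less_iff[of "q - e" z] \<Theta>_less_iff[of s z] by auto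
    have "z < b z \<and> b z < z + min e (min r 1)" using b(2) zs by auto
    then have bz: "z < b z" "b z < z + r" "b z < z + 1" by linarith+
    then have "dist (\<Theta> (b z)) (\<Theta> z) < e" using zs by (intro r(2)) (auto simp: dist_real_def)
    moreover have "\<Theta> z < \<Theta> (b z)" using bz \<Theta>_less_iff by blast
    ultimately show ?thesis using \<Theta>_G[OF b(1), of z] by (simp add: z dist_real_def)
  qed
  then show ?thesis using b(1) by blast
qed

section \<open>Translation numbers compared with \<open>\<Theta>\<close>\<close>

lemma transl_num_pos:
  assumes w: "w \<in> G" and up: "\<And>x. x \<in> {s..\<Theta> s} \<Longrightarrow> x < w x"
  shows "transl_num w > 0"
proof -
  obtain \<delta> where \<delta>: "\<delta> > 0" "\<And>x. x + \<delta> \<le> \<Theta> x" using \<Theta>_ge by blast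
  obtain n where n: "\<Theta> s < (w ^^ n) s" using iterates_cross[OF w up] by blast
  \<comment> \<open>As \<open>w\<close> commutes with \<open>\<Theta>\<close>, passing one period of
    \<open>\<Theta>\<close> in \<open>n\<close> steps propagates to all multiples.\<close>
  have "(\<Theta> ^^ k) s \<le> (w ^^ (n * k)) s" for k
  proof (induction k)
    case (Suc k)
    have "(\<Theta> ^^ Suc k) s \<le> \<Theta> ((w ^^ (n * k)) s)" using Suc \<Theta>_mono by simp
    also have "\<dots> = (w ^^ (n * k)) (\<Theta> s)" by (rule \<Theta>_G[OF G_funpow[OF w]])
    also have "\<dots> \<le> (w ^^ (n * k)) ((w ^^ n) s)" using n G_le[OF G_funpow[OF w]] by (simp add: less_imp_le)
    also have "\<dots> = (w ^^ (n * Suc k)) s" by (simp add: funpow_add add.commute[of n])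
    finally show ?case .
  qed simp
  moreover have "s + of_nat k * \<delta> \<le> (\<Theta> ^^ k) s" for k
  proof (induction k)
    case (Suc k)
    then show ?case using \<delta>(2)[of "(\<Theta> ^^ k) s"] by (simp add: algebra_simps)
  qed simp
  ultimately have "s + of_nat k * \<delta> \<le> (w ^^ (n * k)) s" for k using order_trans by blast
  then have "of_nat n * transl_num w \<ge> \<delta>" by (rule transl_num_ge[OF w])
  then have "of_nat n * transl_num w > 0" using \<delta>(1) by linarith
  then show ?thesis by (simp add: zero_less_mult_iff)
qed

text \<open>By commutation \<open>w\<close> advances at most \<open>k\<close> periods of
  \<open>\<Theta>\<close> in \<open>n * k\<close> steps, and \<open>\<Theta>\<close> moves no point
  by more than 1.\<close>

lemma transl_num_slow:
  assumes w: "w \<in> G" and slow: "(w ^^ n) x \<le> \<Theta> x"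
  shows "of_nat n * transl_num w \<le> 1"
proof -
  have "(w ^^ (n * k)) x \<le> (\<Theta> ^^ k) x" for k
  proof (induction k)
    case (Suc k)
    have "(w ^^ (n * Suc k)) x = (w ^^ (n * k)) ((w ^^ n) x)" by (simp add: funpow_add add.commute[of n])
    also have "\<dots> \<le> (w ^^ (n * k)) (\<Theta> x)" using slow G_le[OF G_funpow[OF w]] by simp
    also have "\<dots> = \<Theta> ((w ^^ (n * k)) x)" by (rule \<Theta>_G[OF G_funpow[OF w], symmetric])
    also have "\<dots> \<le> (\<Theta> ^^ Suc k) x" using Suc \<Theta>_mono by simp
    finally show ?case .
  qed simp
  moreover have "(\<Theta> ^^ k) x \<le> x + of_nat k * 1" for k
  proof (induction k)
    case (Suc k)
    then show ?case using \<Theta>_le[of "(\<Theta> ^^ k) x"] by simp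
  qed simp
  ultimately have "(w ^^ (n * k)) x \<le> x + of_nat k * 1" for k using order_trans by blast
  then show ?thesis by (rule transl_num_le[OF w])
qed


text \<open>Choosing the \<open>b m\<close> whose arc is crossed first serves two aims:
  \<open>a ^^ i\<close> carries points of that arc out of it, so \<open>w\<close> has no fixed
  points, and it oversteps no other arc by much, so \<open>w\<close> needs at least \<open>M\<close>
  steps for a period of \<open>\<Theta>\<close>.\<close>

lemma small_transl_num:
  assumes \<kappa>: "\<kappa> > 0"
  shows "\<exists>w\<in>G. 0 < transl_num w \<and> transl_num w < \<kappa>"
proof -
  obtain \<delta> where \<delta>: "\<delta> > 0" "\<And>x. x + \<delta> \<le> \<Theta> x" using \<Theta>_ge by blast
  obtain M :: nat where M: "1 / \<kappa> < of_nat M" using reals_Archimedean2 by blast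
  have M0: "M > 0" using M \<kappa> by (cases M) (auto simp: divide_less_0_iff not_less)
  \<comment> \<open>The \<open>M\<close> candidate arcs, the arc of \<open>a\<close> at
    \<open>Q\<close> and two further steps of length \<open>\<sigma>\<close> fit into
    \<open>\<delta>\<close>, a lower bound for the periods of \<open>\<Theta>\<close>.\<close>
  define \<sigma> where "\<sigma> = \<delta> / (of_nat M + 3)"
  have "(of_nat M + 3) * \<sigma> = \<delta>" by (simp add: \<sigma>_def)
  moreover have "\<sigma> > 0" using \<delta>(1) by (simp add: \<sigma>_def)
  ultimately have \<sigma>: "\<sigma> > 0" "of_nat M * \<sigma> + 3 * \<sigma> = \<delta>"
    by (simp_all add: distrib_right)
  define e where "e = \<sigma> / 10"
  define q where "q m = of_nat m * \<sigma>" for m :: nat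
  have e: "e > 0" "10 * e = \<sigma>" using \<sigma> by (auto simp: e_def)
  have q_Suc: "q (Suc m) = q m + \<sigma>" for m by (simp add: q_def algebra_simps)
  have q_less: "q m + \<sigma> \<le> q n" if "m < n" for m n
    using mult_right_mono[of "of_nat (Suc m)" "of_nat n" \<sigma>] that \<sigma>(1) by (simp add: q_def algebra_simps)
  have q_mono: "q m \<le> q n" if "m \<le> n" for m n
    using that \<sigma>(1) by (simp add: q_def)
  have q_range: "\<sigma> \<le> q m" "q m + 3 * \<sigma> \<le> \<delta>" if "m \<in> {1..M}" for m
    using that q_mono[of 1 m] q_mono[of m M] \<sigma> by (auto simp: q_def)
  define Q where "Q = q (Suc M)"
  have Q: "q m + \<sigma> \<le> Q" if "m \<in> {1..M}" for m
    using q_less[of m "Suc M"] that by (simp add: Q_def)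
  have Q\<delta>: "Q + 2 * \<sigma> = \<delta>" using q_Suc[of M] \<sigma> by (simp add: Q_def q_def)
  have "\<forall>m. \<exists>b\<in>G. \<forall>x. x \<le> q m - e \<and> q m + e \<le> \<Theta> x \<or> q m + e \<le> x \<and> x \<le> \<Theta> (q m - e) \<longrightarrow> x < b x \<and> b x < x + e"
    using slow_push_periodic[OF e(1)] by blast
  then obtain b where b: "\<And>m. b m \<in> G"
    "\<And>m x. x \<le> q m - e \<and> q m + e \<le> \<Theta> x \<or> q m + e \<le> x \<and> x \<le> \<Theta> (q m - e) \<Longrightarrow> x < b m x \<and> b m x < x + e"
    by metis
  have bQ: "Q < b m Q" if m: "m \<in> {1..M}" for m
  proof -
    have "q m + e \<le> Q \<and> Q \<le> \<Theta> (q m - e)"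
      using Q[OF m] q_range[OF m] Q\<delta> \<delta>(2)[of "q m - e"] e \<sigma>(1) by linarith
    then show ?thesis using b(2) by blast
  qed
  \<comment> \<open>Each \<open>b m\<close> pushes \<open>Q\<close> to the right, so by continuity
    it jumps over a sufficiently small arc around \<open>Q\<close>. The radius \<open>t\<close> is
    taken to work for all \<open>M\<close> candidates before \<open>a\<close> is chosen.\<close>
  have "eventually (\<lambda>t. Q + t < b m (Q - t)) (at_right 0)" if m: "m \<in> {1..M}" for m
  proof -
    have "((\<lambda>t. b m (Q - t)) \<longlongrightarrow> b m (Q - 0)) (at_right 0)"
      by (rule isCont_tendsto_compose[OF G_isCont[OF b(1)]]) (intro tendsto_intros)
    then have "((\<lambda>t. b m (Q - t) - (Q + t)) \<longlongrightarrow> b m (Q - 0) - (Q + 0)) (at_right 0)"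
      by (intro tendsto_intros)
    then have "eventually (\<lambda>t. 0 < b m (Q - t) - (Q + t)) (at_right 0)"
      using bQ[OF m] by (intro order_tendstoD) auto
    then show ?thesis by eventually_elim simp
  qed
  then have "eventually (\<lambda>t. \<forall>m\<in>{1..M}. Q + t < b m (Q - t)) (at_right 0)"
    by (intro eventually_ball_finite) auto
  moreover have "eventually (\<lambda>t. t \<in> {0<..<e}) (at_right 0)"
    by (rule eventually_at_right_real[OF e(1)])
  ultimately have "eventually (\<lambda>t. (\<forall>m\<in>{1..M}. Q + t < b m (Q - t)) \<and> t \<in> {0<..<e}) (at_right 0)"
    by (rule eventually_conj)
  from eventually_happens'[OF trivial_limit_at_right_real this]
  obtain t where t: "t > 0" "t < e" "\<And>m. m \<in> {1..M} \<Longrightarrow> Q + t < b m (Q - t)" by auto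
  obtain s s' where s: "s < s'" "Q - t < s'" "s' < \<Theta> s" "\<Theta> s < Q + t"
    "\<And>e2. e2 > 0 \<Longrightarrow> \<exists>a\<in>G. \<forall>x\<in>{s..s'}. x < a x \<and> a x < x + e2"
    using slow_push[OF t(1), of Q] by blast
  have s0: "s < 0" using \<delta>(2)[of s] s(4) t(2) e Q\<delta> \<sigma>(1) by linarith
  obtain a where a: "a \<in> G" "\<And>x. x \<in> {s..s'} \<Longrightarrow> x < a x \<and> a x < x + \<sigma> / 4"
    using s(5)[of "\<sigma> / 4"] \<sigma>(1) by auto
  have arc: "s \<le> q m - e" "q m + e \<le> s'" if m: "m \<in> {1..M}" for m
    using q_range[OF m] s0 s(2) t(2) Q[OF m] e by linarith+
  define cross where "cross m n \<longleftrightarrow> q m + e \<le> (a ^^ n) (q m - e)" for m n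
  have "\<exists>n. cross m n" if m: "m \<in> {1..M}" for m
  proof -
    have "\<exists>n. q m + e < (a ^^ n) (q m - e)"
      by (rule iterates_cross[OF a(1)]) (use a(2) arc[OF m] in auto)
    then show ?thesis unfolding cross_def using less_imp_le by blast
  qed
  then have ex: "\<exists>n. \<exists>m\<in>{1..M}. cross m n" using M0 by force
  \<comment> \<open>At time \<open>i\<close> some arc is crossed, whereas at time
    \<open>i - 1\<close> none is.\<close>
  define i where "i = (LEAST n. \<exists>m\<in>{1..M}. cross m n)"
  obtain m where m: "m \<in> {1..M}" "cross m i" using LeastI_ex[OF ex] unfolding i_def by blast
  have ncross: "\<not> cross j n" if "j \<in> {1..M}" "n < i" for j n
    using not_less_Least[of n "\<lambda>n. \<exists>m\<in>{1..M}. cross m n"] that unfolding i_def by blast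
  have "i \<noteq> 0" using m(2) e(1) by (intro notI) (simp add: cross_def)
  then obtain i' where i': "i = Suc i'" by (cases i) auto
  define w where "w = b m \<circ> a ^^ i"
  have w: "w \<in> G" unfolding w_def by (intro G_comp b G_funpow a)
  have "x < w x" if x: "x \<in> {s..\<Theta> s}" for x
  proof (cases "x \<le> s'")
    case False
    \<comment> \<open>In its own exceptional arc \<open>a\<close> may move points to the left, but
      not below \<open>s'\<close>; from there \<open>b m\<close> carries them beyond
      \<open>\<Theta> s\<close>.\<close>
    have "s' \<le> (a ^^ n) x" for n
    proof (induction n)
      case (Suc n)
      have "s' < a s'" using a(2)[of s'] s(1) by auto
      also have "\<dots> \<le> a ((a ^^ n) x)" using Suc G_le[OF a(1)] by blast
      finally show ?case by simp
    qed (use False in auto)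
    then have "Q - t \<le> (a ^^ i) x" using s(2) by (meson less_imp_le order_trans)
    then have "b m (Q - t) \<le> w x" unfolding w_def using G_le[OF b(1)] by simp
    then show ?thesis using t(3)[OF m(1)] s(4) x by auto
  next
    case True
    then have ax: "x < a x" using a(2) x by auto
    have up: "x < (a ^^ Suc n) x" for n
    proof (induction n)
      case (Suc n)
      have "x < a x" by (rule ax)
      also have "a x < a ((a ^^ Suc n) x)" using Suc G_less[OF a(1)] by blast
      finally show ?case by simp
    qed (simp add: ax)
    show ?thesis
    proof (cases "x \<in> {q m - e<..<q m + e}")
      case False
      have "x \<le> q m - e \<and> q m + e \<le> \<Theta> x \<or> q m + e \<le> x \<and> x \<le> \<Theta> (q m - e)"
      proof (cases "x \<le> q m - e")
        case True
        have "\<Theta> s \<le> \<Theta> x" using \<Theta>_mono x by auto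
        then show ?thesis using True s(2,3) t(2) Q[OF m(1)] e by linarith
      next
        case not_le: False
        then have "q m + e \<le> x" using False by auto
        moreover have "x \<le> \<Theta> (q m - e)"
          using x s(4) t(2) Q\<delta> q_range(1)[OF m(1)] \<delta>(2)[of "q m - e"] e by auto
        ultimately show ?thesis by blast
      qed
      then have "x < b m x" using b(2) by blast
      also have "b m x < w x" unfolding w_def i' using up[of i'] G_less[OF b(1)] by simp
      finally show ?thesis .
    next
      case True
      then have "(a ^^ i) (q m - e) \<le> (a ^^ i) x" using G_le[OF G_funpow[OF a(1)]] by auto
      then have "q m + e \<le> (a ^^ i) x" using m(2) unfolding cross_def by linarith
      then have "b m (q m + e) \<le> w x" unfolding w_def using G_le[OF b(1)] by simp
      moreover have "q m + e \<le> \<Theta> (q m - e)"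
        using \<delta>(2)[of "q m - e"] q_range[OF m(1)] e by linarith
      then have "q m + e < b m (q m + e)" using b(2)[of "q m + e" m] by simp
      ultimately show ?thesis using True by auto
    qed
  qed
  then have pos: "transl_num w > 0" by (rule transl_num_pos[OF w])
  have step: "w (q j - e) \<le> q (Suc j) - e" if j: "j \<in> {1..M}" for j
  proof -
    \<comment> \<open>Before its last step \<open>a ^^ i\<close> has not crossed the arc of
      \<open>q j\<close>, so it oversteps the arc by less than \<open>\<sigma> / 4\<close>. The
      point \<open>T\<close> avoids the exceptional arc of \<open>b m\<close>, which therefore adds
      less than \<open>e\<close>.\<close>
    define T where "T = q j + e + \<sigma> / 4"
    have "(a ^^ i') (q j - e) < q j + e" using ncross[OF j, of i'] i' by (simp add: cross_def)
    then have "(a ^^ i) (q j - e) < a (q j + e)" using G_less[OF a(1)] by (simp add: i')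
    also have "a (q j + e) < T"
      using a(2)[of "q j + e"] arc[OF j] e(1) by (auto simp: T_def)
    finally have "w (q j - e) \<le> b m T" unfolding w_def using G_less[OF b(1)] by (simp add: less_imp_le)
    moreover have "T \<le> q m - e \<and> q m + e \<le> \<Theta> T \<or> q m + e \<le> T \<and> T \<le> \<Theta> (q m - e)"
    proof (cases "j < m")
      case True
      then show ?thesis
        using q_less[OF True] \<delta>(2)[of T] q_range[OF m(1)] q_range[OF j] e unfolding T_def by linarith
    next
      case False
      then have "q m \<le> q j" by (intro q_mono) auto
      then show ?thesis
        using \<delta>(2)[of "q m - e"] q_range[OF m(1)] q_range[OF j] e unfolding T_def by linarith
    qed
    then have "b m T < T + e" using b(2) by blast
    ultimately show ?thesis using q_Suc[of j] e unfolding T_def by linarith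
  qed
  have "(w ^^ n) (q 1 - e) \<le> q (Suc n) - e" if "n \<le> M" for n
    using that
  proof (induction n)
    case (Suc n)
    then have "(w ^^ Suc n) (q 1 - e) \<le> w (q (Suc n) - e)" using G_le[OF w] by simp
    also have "\<dots> \<le> q (Suc (Suc n)) - e" using step[of "Suc n"] Suc.prems by auto
    finally show ?case .
  qed simp
  \<comment> \<open>The \<open>M\<close> steps end at or before \<open>Q - e\<close>, still within
    one period of \<open>\<Theta>\<close>.\<close>
  from this[of M] have "(w ^^ M) (q 1 - e) \<le> \<Theta> (q 1 - e)"
    using \<delta>(2)[of "q 1 - e"] q_range[of 1] M0 Q\<delta> \<sigma>(1) unfolding Q_def by auto
  then have "of_nat M * transl_num w \<le> 1" by (rule transl_num_slow[OF w])
  then have "transl_num w \<le> 1 / of_nat M" using M0 by (simp add: field_simps)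
  also have "\<dots> < \<kappa>" using M \<kappa> M0 by (simp add: field_simps)
  finally show ?thesis using pos w by blast
qed

end

theorem theorem1p2:
  fixes G :: "(real \<Rightarrow> real) set"
  assumes "lifted_subgroup G"
    and "C1_nondiscrete G"
  shows "finite (rot_image G) \<longleftrightarrow> has_finite_orbit G"
proof -
  interpret circle_group G by unfold_locales (rule assms(1))
  have "has_finite_orbit G" if fin: "finite (rot_image G)"
  proof (rule ccontr)
    assume nofin: "\<not> has_finite_orbit G"
    obtain \<kappa> where \<kappa>: "\<kappa> > 0" "\<And>F. F \<in> G \<Longrightarrow> \<bar>transl_num F\<bar> < \<kappa> \<Longrightarrow> transl_num F = 0"
      using finite_rot_imp_gap[OF fin] by blast
    obtain c d \<alpha> \<beta> where "\<And>z u v. u < v \<Longrightarrow> \<exists>F\<in>G. F z \<in> {u<..<v}"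
      "c < d" "\<And>e. e > 0 \<Longrightarrow> \<exists>F\<in>G. F d - F c < e"
      "\<alpha> < \<beta>" "\<And>e. e > 0 \<Longrightarrow> \<exists>\<phi>\<in>G. \<forall>x\<in>{\<alpha>..\<beta>}. x < \<phi> x \<and> \<phi> x < x + e"
      using minimal_with_small_moves[OF fin nofin assms(2)] by blast
    then interpret proximal G c d \<alpha> \<beta> by unfold_locales
    obtain w where "w \<in> G" "0 < transl_num w" "transl_num w < \<kappa>"
      using small_transl_num[OF \<kappa>(1)] by blast
    then show False using \<kappa>(2)[of w] by simp
  qed
  then show ?thesis using finite_orbit_imp_finite_rot by blast
qed

end
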